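(* For every relevant modal logic $\mathsf{L}$ (determined by a set $\Phi$ of frame conditions from the table below), the set of theorems of the axiom system $\mathsf{CL}$ coincides with the logic $\mathsf{CL}$, i.e. with the set of formulas valid in all $\mathsf{CL}$-frames.
   Context: Language: a countable set $Pr$ of propositional variables, binary connectives $\land,\lor,\to$ and unary connectives $\neg,\Box,\Box_L$; $\varphi\leftrightarrow\psi:=(\varphi\to\psi)\land(\psi\to\varphi)$. Frames and interpretation. A frame is $F=(S,\leq,R,*,Q,Q_L)$ where $(S,\leq)$ is a poset; $R\subseteq S^3$ satisfies: if $Rstu$, $s'\leq s$, $t'\leq t$, $u\leq u'$ then $Rs't'u'$; $*:S\to S$ satisfies $s\leq t\Rightarrow t^*\leq s^*$; $Q,Q_L\subseteq S^2$ satisfy: if $Qst$, $s'\leq s$, $t\leq t'$ then $Qs't'$ (same for $Q_L$). A valuation maps each $p$ to an up-set. $[\![p]\!]=V(p)$; $\land$ intersection, $\lor$ union; $[\![\neg\varphi]\!]=\{s: s^*\notin[\![\varphi]\!]\}$; $[\![\varphi\to\psi]\!]=\{s:\forall t,u\,(Rstu \text{ and } t\in[\![\varphi]\!]\Rightarrow u\in[\![\psi]\!])\}$; $[\![\Box\varphi]\!]=\{s:\forall t\,(Qst\Rightarrow t\in[\![\varphi]\!])\}$; $[\![\Box_L\varphi]\!]$ likewise with $Q_L$. $W$-frames. A frame is bounded if $(S,\le)$ has least element $0$ and greatest $1$ and $1^*=0$, $0^*=1$, $Q00$, $Q_L00$, $Q1s\Rightarrow s=1$, $Q_L1s\Rightarrow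 s=1$, $R010$, $R1st\Rightarrow(s=0$ or $t=1)$. A possible world is $w$ with $w^*=w$, $Rwww$, $Rwst\Rightarrow(s=0$ or $w\le t)$, $Rwst\Rightarrow(t=1$ or $s\le w^* )$. A $W$-frame is $(F,W)$ with $F$ bounded, $W$ a set of possible worlds, such that (a) for $w\in W$: $Q_Lwu$ and $Rust$ imply $s\le t$; (b) for every $s$ there are $w\in W$, $u$ with $Q_Lwu$ and $Russ$. A $W$-model is a $W$-frame with a valuation whose values are up-sets containing $1$ and not $0$; $\varphi$ is valid in it iff $W\subseteq[\![\varphi]\!]$; valid in a frame iff valid in every $W$-model on it. Frame conditions and corresponding axioms/rules (free variables universal; $Rstuv:=\exists x(Rstx\,\&\,Rxuv)$, $Rs(tu)v:=\exists x(Rtux\,\&\,Rsxv)$, $RQstu:=\exists x(Rstx\,\&\,Qxu)$, $QRstu:=\exists x(Qsx\,\&\,Rxtu)$): (DN) $s^{**}=s$ / $p\leftrightarrow\neg\neg p$; (Cp) $Rstu\Rightarrow Rsu^*t^*$ / $(p\to q)\to(\neg q\to\neg p)$; (WB) $Rstu\Rightarrow Rs(st)u$ / $((p\to q)\land(q\to r))\to(p\to r)$; (X) $s\in L\Rightarrow s^*\le s$ / $p\lor\neg p$; (Rd) $Rss^*s$ / $(p\to\neg p)\to\neg p$; (B) $Rstuv\Rightarrow Rs(tu)v$ / $(p\to q)\to((r\to p)\to(r\to q))$; (CB) $Rstuv\Rightarrow Rt(su)v$ / $(p\to q)\to((q\to r)\to(p\to r))$; (W) $Rstu\Rightarrow Rsttu$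 / $(p\to(p\to q))\to(p\to q)$; (C) $Rstuv\Rightarrow Rsutv$ / $(p\to(q\to r))\to(q\to(p\to r))$; (M) $Rstu\Rightarrow(s\le u$ or $t\le u)$ / $p\to(p\to p)$; (ER) $\exists x(x\in L\,\&\,Rsxs)$ / rule: from $\varphi$ infer $(\varphi\to\psi)\to\psi$; (Nec) $(x\in L\,\&\,Qxs)\Rightarrow s\in L$ / rule: from $\varphi$ infer $\Box\varphi$; ($\Box$K) $RQstu\Rightarrow\exists x(Qtx\,\&\,QRsxu)$ / $\Box(p\to q)\to(\Box p\to\Box q)$; ($\Box$T) $Qss$ / $\Box p\to p$; ($\Box$D) $\exists x(Qsx^*\,\&\,Qs^*x)$ / $\Box\neg p\to\neg\Box p$; ($\Box$4) $(Qst\,\&\,Qtu)\Rightarrow Qsu$ / $\Box p\to\Box\Box p$; ($\Box$5) $(Qs^*u\,\&\,Qst)\Rightarrow Qt^*u$ / $\neg\Box p\to\Box\neg\Box p$. The C-variant of a condition replaces every "$s\in L$" by "$\exists w(w\in W\,\&\,Q_Lws)$" ($w$ fresh). A $\mathsf{CL}$-frame is a $W$-frame satisfying the C-variants of the conditions in the chosen set $\Phi$. Axiom systems. $\mathsf{L}$ is $\mathsf{BM.C}$ plus the axioms/rules corresponding to $\Phi$, where $\mathsf{BM.C}$ has axioms $p\to p$; $\neg(p\land q)\to(\neg p\lor\neg q)$; $(\neg p\land\neg q)\to\neg(p\lor q)$; $(p\land q)\to p$; $(p\land q)\to q$; $p\to(p\lor q)$; $q\to(p\lor q)$; $((p\to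 q)\land(p\to r))\to(p\to(q\land r))$; $((p\to r)\land(q\to r))\to((p\lor q)\to r)$; $(p\land(q\lor r))\to((p\land q)\lor(p\land r))$; $(\Box p\land\Box q)\to\Box(p\land q)$; $(\Box_Lp\land\Box_Lq)\to\Box_L(p\land q)$; rules: uniform substitution, modus ponens, adjunction ($\varphi,\psi/\varphi\land\psi$), affixing ($\varphi'\to\varphi,\ \psi\to\psi'/(\varphi\to\psi)\to(\varphi'\to\psi')$), contraposition ($\varphi\to\psi/\neg\psi\to\neg\varphi$), $\Box$-monotonicity ($\varphi\to\psi/\Box\varphi\to\Box\psi$), $\Box_L$-monotonicity (same with $\Box_L$). The axiom system $\mathsf{CL}$ consists of: classical propositional logic (all substitution instances over the full language, $\neg,\to,\land,\lor$ read classically), modus ponens, uniform substitution; an axiom $\Box_L\varphi$ for each axiom $\varphi$ of $\mathsf{L}$; for each inference rule $\varphi_1,\dots,\varphi_n/\psi$ of $\mathsf{L}$, the rule $\Box_L\varphi_1,\dots,\Box_L\varphi_n/\Box_L\psi$; and the Bridge Rule: from $\Box_L(\varphi\to\psi)$ infer $\varphi\to\psi$.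
   Formalization: Stated only for Φ in which (□D) is accompanied by (DN), and (Rd) by (DN) or by all of (Cp), (X), (C), (M); for every other Φ the claim is false, because the condition (□D) or (Rd) then validates formulas that are not theorems of CL. *)

theory Defs
  imports Main
begin

datatype fm =
    Var nat
  | Neg fm ("\<^bold>\<not> _" [90] 90)
  | And fm fm (infixr "\<^bold>\<and>" 85)
  | Or fm fm (infixr "\<^bold>\<or>" 80)
  | Imp fm fm (infixr "\<^bold>\<rightarrow>" 75)
  | Box fm ("\<^bold>\<box> _" [90] 90)
  | BoxL fm ("\<^bold>\<box>\<^sub>L _" [90] 90)

definition Iff :: "fm \<Rightarrow> fm \<Rightarrow> fm" (infix "\<^bold>\<leftrightarrow>" 70) where
  "\<phi> \<^bold>\<leftrightarrow> \<psi> = ((\<phi> \<^bold>\<rightarrow> \<psi>) \<^bold>\<and> (\<psi> \<^bold>\<rightarrow> \<phi>))"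

primrec subst :: "(nat \<Rightarrow> fm) \<Rightarrow> fm \<Rightarrow> fm" where
  "subst \<sigma> (Var n) = \<sigma> n"
| "subst \<sigma> (\<^bold>\<not> \<phi>) = \<^bold>\<not> (subst \<sigma> \<phi>)"
| "subst \<sigma> (\<phi> \<^bold>\<and> \<psi>) = subst \<sigma> \<phi> \<^bold>\<and> subst \<sigma> \<psi>"
| "subst \<sigma> (\<phi> \<^bold>\<or> \<psi>) = subst \<sigma> \<phi> \<^bold>\<or> subst \<sigma> \<psi>"
| "subst \<sigma> (\<phi> \<^bold>\<rightarrow> \<psi>) = subst \<sigma> \<phi> \<^bold>\<rightarrow> subst \<sigma> \<psi>"
| "subst \<sigma> (\<^bold>\<box> \<phi>) = \<^bold>\<box> (subst \<sigma> \<phi>)"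
| "subst \<sigma> (\<^bold>\<box>\<^sub>L \<phi>) = \<^bold>\<box>\<^sub>L (subst \<sigma> \<phi>)"


section \<open>Frames and models\<close>

text \<open>The carrier is an explicit set, so that frames over a type \<open>'s\<close> are all frames whose points
  form a subset of \<open>'s\<close>. Only the restriction of \<open>star\<close> to the carrier is meaningful.\<close>

record 's frame =
  pts :: "'s set"
  ord :: "('s \<times> 's) set"
  ter :: "('s \<times> 's \<times> 's) set"
  star :: "'s \<Rightarrow> 's"
  acc :: "('s \<times> 's) set"
  accL :: "('s \<times> 's) set"

definition is_frame :: "'s frame \<Rightarrow> bool" where
  "is_frame F \<longleftrightarrow>
     partial_order_on (pts F) (ord F) \<and>
     ter F \<subseteq> pts F \<times> pts F \<times> pts F \<and>
     (\<forall>s t u s' t' u'. (s, t, u) \<in> ter F \<and> (s', s) \<in> ord F \<and> (t', t) \<in> ord F \<and> (u, u') \<in> ord F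
        \<longrightarrow> (s', t', u') \<in> ter F) \<and>
     star F ` pts F \<subseteq> pts F \<and>
     (\<forall>s t. (s, t) \<in> ord F \<longrightarrow> (star F t, star F s) \<in> ord F) \<and>
     acc F \<subseteq> pts F \<times> pts F \<and>
     (\<forall>s t s' t'. (s, t) \<in> acc F \<and> (s', s) \<in> ord F \<and> (t, t') \<in> ord F \<longrightarrow> (s', t') \<in> acc F) \<and>
     accL F \<subseteq> pts F \<times> pts F \<and>
     (\<forall>s t s' t'. (s, t) \<in> accL F \<and> (s', s) \<in> ord F \<and> (t, t') \<in> ord F \<longrightarrow> (s', t') \<in> accL F)"

definition up_set :: "'s frame \<Rightarrow> 's set \<Rightarrow> bool" where
  "up_set F X \<longleftrightarrow> X \<subseteq> pts F \<and> (\<forall>s t. s \<in> X \<and> (s, t) \<in> ord F \<longrightarrow> t \<in> X)"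

primrec ext :: "'s frame \<Rightarrow> (nat \<Rightarrow> 's set) \<Rightarrow> fm \<Rightarrow> 's set" where
  "ext F V (Var n) = V n"
| "ext F V (\<^bold>\<not> \<phi>) = {s \<in> pts F. star F s \<notin> ext F V \<phi>}"
| "ext F V (\<phi> \<^bold>\<and> \<psi>) = ext F V \<phi> \<inter> ext F V \<psi>"
| "ext F V (\<phi> \<^bold>\<or> \<psi>) = ext F V \<phi> \<union> ext F V \<psi>"
| "ext F V (\<phi> \<^bold>\<rightarrow> \<psi>) =
     {s \<in> pts F. \<forall>t u. (s, t, u) \<in> ter F \<and> t \<in> ext F V \<phi> \<longrightarrow> u \<in> ext F V \<psi>}"
| "ext F V (\<^bold>\<box> \<phi>) = {s \<in> pts F. \<forall>t. (s, t) \<in> acc F \<longrightarrow> t \<in> ext F V \<phi>}"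
| "ext F V (\<^bold>\<box>\<^sub>L \<phi>) = {s \<in> pts F. \<forall>t. (s, t) \<in> accL F \<longrightarrow> t \<in> ext F V \<phi>}"

definition is_least :: "'s frame \<Rightarrow> 's \<Rightarrow> bool" where
  "is_least F z \<longleftrightarrow> z \<in> pts F \<and> (\<forall>s\<in>pts F. (z, s) \<in> ord F)"

definition is_greatest :: "'s frame \<Rightarrow> 's \<Rightarrow> bool" where
  "is_greatest F e \<longleftrightarrow> e \<in> pts F \<and> (\<forall>s\<in>pts F. (s, e) \<in> ord F)"

definition bot_pt :: "'s frame \<Rightarrow> 's" where
  "bot_pt F = (THE z. is_least F z)"

definition top_pt :: "'s frame \<Rightarrow> 's" where
  "top_pt F = (THE e. is_greatest F e)"

definition bounded_frame :: "'s frame \<Rightarrow> bool" where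
  "bounded_frame F \<longleftrightarrow>
     is_frame F \<and> (\<exists>z. is_least F z) \<and> (\<exists>e. is_greatest F e) \<and>
     star F (top_pt F) = bot_pt F \<and> star F (bot_pt F) = top_pt F \<and>
     (bot_pt F, bot_pt F) \<in> acc F \<and> (bot_pt F, bot_pt F) \<in> accL F \<and>
     (\<forall>s. (top_pt F, s) \<in> acc F \<longrightarrow> s = top_pt F) \<and>
     (\<forall>s. (top_pt F, s) \<in> accL F \<longrightarrow> s = top_pt F) \<and>
     (bot_pt F, top_pt F, bot_pt F) \<in> ter F \<and>
     (\<forall>s t. (top_pt F, s, t) \<in> ter F \<longrightarrow> s = bot_pt F \<or> t = top_pt F)"

definition possible_world :: "'s frame \<Rightarrow> 's \<Rightarrow> bool" where
  "possible_world F w \<longleftrightarrow>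
     w \<in> pts F \<and> star F w = w \<and> (w, w, w) \<in> ter F \<and>
     (\<forall>s t. (w, s, t) \<in> ter F \<longrightarrow> s = bot_pt F \<or> (w, t) \<in> ord F) \<and>
     (\<forall>s t. (w, s, t) \<in> ter F \<longrightarrow> t = top_pt F \<or> (s, star F w) \<in> ord F)"

definition W_frame :: "'s frame \<Rightarrow> 's set \<Rightarrow> bool" where
  "W_frame F W \<longleftrightarrow>
     bounded_frame F \<and> (\<forall>w\<in>W. possible_world F w) \<and>
     (\<forall>w\<in>W. \<forall>u s t. (w, u) \<in> accL F \<and> (u, s, t) \<in> ter F \<longrightarrow> (s, t) \<in> ord F) \<and>
     (\<forall>s\<in>pts F. \<exists>w\<in>W. \<exists>u. (w, u) \<in> accL F \<and> (u, s, s) \<in> ter F)"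

definition W_valuation :: "'s frame \<Rightarrow> (nat \<Rightarrow> 's set) \<Rightarrow> bool" where
  "W_valuation F V \<longleftrightarrow> (\<forall>n. up_set F (V n) \<and> top_pt F \<in> V n \<and> bot_pt F \<notin> V n)"

definition valid_in_frame :: "'s frame \<Rightarrow> 's set \<Rightarrow> fm \<Rightarrow> bool" where
  "valid_in_frame F W \<phi> \<longleftrightarrow> (\<forall>V. W_valuation F V \<longrightarrow> W \<subseteq> ext F V \<phi>)"


section \<open>Frame conditions and the logic CL\<close>

datatype cond = cDN | cCp | cWB | cX | cRd | cB | cCB | cW | cC | cM | cER | cNec
  | cBoxK | cBoxT | cBoxD | cBox4 | cBox5

text \<open>The parameter \<open>L\<close> is the set of logical points occurring in some of the conditions.\<close>

fun cond_holds :: "'s frame \<Rightarrow> 's set \<Rightarrow> cond \<Rightarrow> bool" where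
  "cond_holds F L cDN \<longleftrightarrow> (\<forall>s\<in>pts F. star F (star F s) = s)"
| "cond_holds F L cCp \<longleftrightarrow> (\<forall>s t u. (s, t, u) \<in> ter F \<longrightarrow> (s, star F u, star F t) \<in> ter F)"
| "cond_holds F L cWB \<longleftrightarrow> (\<forall>s t u. (s, t, u) \<in> ter F \<longrightarrow>
     (\<exists>x. (s, t, x) \<in> ter F \<and> (s, x, u) \<in> ter F))"
| "cond_holds F L cX \<longleftrightarrow> (\<forall>s\<in>pts F. s \<in> L \<longrightarrow> (star F s, s) \<in> ord F)"
| "cond_holds F L cRd \<longleftrightarrow> (\<forall>s\<in>pts F. (s, star F s, s) \<in> ter F)"
| "cond_holds F L cB \<longleftrightarrow> (\<forall>s t u v. (\<exists>x. (s, t, x) \<in> ter F \<and> (x, u, v) \<in> ter F) \<longrightarrow>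
     (\<exists>x. (t, u, x) \<in> ter F \<and> (s, x, v) \<in> ter F))"
| "cond_holds F L cCB \<longleftrightarrow> (\<forall>s t u v. (\<exists>x. (s, t, x) \<in> ter F \<and> (x, u, v) \<in> ter F) \<longrightarrow>
     (\<exists>x. (s, u, x) \<in> ter F \<and> (t, x, v) \<in> ter F))"
| "cond_holds F L cW \<longleftrightarrow> (\<forall>s t u. (s, t, u) \<in> ter F \<longrightarrow>
     (\<exists>x. (s, t, x) \<in> ter F \<and> (x, t, u) \<in> ter F))"
| "cond_holds F L cC \<longleftrightarrow> (\<forall>s t u v. (\<exists>x. (s, t, x) \<in> ter F \<and> (x, u, v) \<in> ter F) \<longrightarrow>
     (\<exists>x. (s, u, x) \<in> ter F \<and> (x, t, v) \<in> ter F))"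
| "cond_holds F L cM \<longleftrightarrow> (\<forall>s t u. (s, t, u) \<in> ter F \<longrightarrow> (s, u) \<in> ord F \<or> (t, u) \<in> ord F)"
| "cond_holds F L cER \<longleftrightarrow> (\<forall>s\<in>pts F. \<exists>x. x \<in> L \<and> (s, x, s) \<in> ter F)"
| "cond_holds F L cNec \<longleftrightarrow> (\<forall>x s. x \<in> L \<and> (x, s) \<in> acc F \<longrightarrow> s \<in> L)"
| "cond_holds F L cBoxK \<longleftrightarrow> (\<forall>s t u. (\<exists>x. (s, t, x) \<in> ter F \<and> (x, u) \<in> acc F) \<longrightarrow>
     (\<exists>x. (t, x) \<in> acc F \<and> (\<exists>y. (s, y) \<in> acc F \<and> (y, x, u) \<in> ter F)))"
| "cond_holds F L cBoxT \<longleftrightarrow> (\<forall>s\<in>pts F. (s, s) \<in> acc F)"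
| "cond_holds F L cBoxD \<longleftrightarrow> (\<forall>s\<in>pts F. \<exists>x\<in>pts F. (s, star F x) \<in> acc F \<and> (star F s, x) \<in> acc F)"
| "cond_holds F L cBox4 \<longleftrightarrow> (\<forall>s t u. (s, t) \<in> acc F \<and> (t, u) \<in> acc F \<longrightarrow> (s, u) \<in> acc F)"
| "cond_holds F L cBox5 \<longleftrightarrow> (\<forall>s\<in>pts F. \<forall>t u.
     (star F s, u) \<in> acc F \<and> (s, t) \<in> acc F \<longrightarrow> (star F t, u) \<in> acc F)"

text \<open>The C-variant of a condition is the condition with \<open>L\<close> instantiated to the set of points
  \<open>s\<close> such that \<open>Q\<^sub>L w s\<close> for some \<open>w \<in> W\<close>.\<close>

definition CL_frame :: "cond set \<Rightarrow> 's frame \<Rightarrow> 's set \<Rightarrow> bool" where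
  "CL_frame \<Phi> F W \<longleftrightarrow>
     W_frame F W \<and> (\<forall>c\<in>\<Phi>. cond_holds F {s. \<exists>w\<in>W. (w, s) \<in> accL F} c)"

text \<open>HOL cannot quantify over all types inside a formula, so the class of frames is restricted to
  those with points in \<open>'s\<close>.\<close>

definition CL_logic :: "'s itself \<Rightarrow> cond set \<Rightarrow> fm set" where
  "CL_logic T \<Phi> = {\<phi>. \<forall>(F :: 's frame) W. CL_frame \<Phi> F W \<longrightarrow> valid_in_frame F W \<phi>}"


text \<open>Two of the correspondences rely on double negation. Without \<open>cDN\<close> the condition \<open>cBoxD\<close> validates
  \<open>\<box>p \<rightarrow> \<not>\<box>\<not>p\<close>, which is not derivable from the corresponding axiom, and the axiom itself need not be
  valid. Likewise \<open>cRd\<close> validates \<open>(p \<rightarrow> q) \<rightarrow> (\<not>p \<or> q)\<close>, which without \<open>cDN\<close> is underivable unless all of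
  \<open>cCp\<close>, \<open>cX\<close>, \<open>cC\<close>, \<open>cM\<close> are present; those four together already entail the condition \<open>cRd\<close>. A
  completeness statement for a set of conditions therefore has to exclude the remaining cases.\<close>


section \<open>The axiom system CL\<close>

abbreviation vp :: fm where "vp \<equiv> Var 0"
abbreviation vq :: fm where "vq \<equiv> Var 1"
abbreviation vr :: fm where "vr \<equiv> Var 2"

text \<open>An inference rule is represented by the set of its instances (list of premises, conclusion).\<close>

type_synonym rule_set = "(fm list \<times> fm) set"

definition BMC_axioms :: "fm set" where
  "BMC_axioms = {
     vp \<^bold>\<rightarrow> vp,
     \<^bold>\<not> (vp \<^bold>\<and> vq) \<^bold>\<rightarrow> (\<^bold>\<not> vp \<^bold>\<or> \<^bold>\<not> vq),
     (\<^bold>\<not> vp \<^bold>\<and> \<^bold>\<not> vq) \<^bold>\<rightarrow> \<^bold>\<not> (vp \<^bold>\<or> vq),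
     (vp \<^bold>\<and> vq) \<^bold>\<rightarrow> vp,
     (vp \<^bold>\<and> vq) \<^bold>\<rightarrow> vq,
     vp \<^bold>\<rightarrow> (vp \<^bold>\<or> vq),
     vq \<^bold>\<rightarrow> (vp \<^bold>\<or> vq),
     ((vp \<^bold>\<rightarrow> vq) \<^bold>\<and> (vp \<^bold>\<rightarrow> vr)) \<^bold>\<rightarrow> (vp \<^bold>\<rightarrow> (vq \<^bold>\<and> vr)),
     ((vp \<^bold>\<rightarrow> vr) \<^bold>\<and> (vq \<^bold>\<rightarrow> vr)) \<^bold>\<rightarrow> ((vp \<^bold>\<or> vq) \<^bold>\<rightarrow> vr),
     (vp \<^bold>\<and> (vq \<^bold>\<or> vr)) \<^bold>\<rightarrow> ((vp \<^bold>\<and> vq) \<^bold>\<or> (vp \<^bold>\<and> vr)),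
     (\<^bold>\<box> vp \<^bold>\<and> \<^bold>\<box> vq) \<^bold>\<rightarrow> \<^bold>\<box> (vp \<^bold>\<and> vq),
     (\<^bold>\<box>\<^sub>L vp \<^bold>\<and> \<^bold>\<box>\<^sub>L vq) \<^bold>\<rightarrow> \<^bold>\<box>\<^sub>L (vp \<^bold>\<and> vq)}"

inductive_set BMC_rules :: rule_set where
  substitution: "([\<phi>], subst \<sigma> \<phi>) \<in> BMC_rules"
| modus_ponens: "([\<phi>, \<phi> \<^bold>\<rightarrow> \<psi>], \<psi>) \<in> BMC_rules"
| adjunction: "([\<phi>, \<psi>], \<phi> \<^bold>\<and> \<psi>) \<in> BMC_rules"
| affixing: "([\<phi>' \<^bold>\<rightarrow> \<phi>, \<psi> \<^bold>\<rightarrow> \<psi>'], (\<phi> \<^bold>\<rightarrow> \<psi>) \<^bold>\<rightarrow> (\<phi>' \<^bold>\<rightarrow> \<psi>')) \<in> BMC_rules"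
| contraposition: "([\<phi> \<^bold>\<rightarrow> \<psi>], \<^bold>\<not> \<psi> \<^bold>\<rightarrow> \<^bold>\<not> \<phi>) \<in> BMC_rules"
| Box_mono: "([\<phi> \<^bold>\<rightarrow> \<psi>], \<^bold>\<box> \<phi> \<^bold>\<rightarrow> \<^bold>\<box> \<psi>) \<in> BMC_rules"
| BoxL_mono: "([\<phi> \<^bold>\<rightarrow> \<psi>], \<^bold>\<box>\<^sub>L \<phi> \<^bold>\<rightarrow> \<^bold>\<box>\<^sub>L \<psi>) \<in> BMC_rules"

fun cond_axioms :: "cond \<Rightarrow> fm set" where
  "cond_axioms cDN = {vp \<^bold>\<leftrightarrow> \<^bold>\<not> (\<^bold>\<not> vp)}"
| "cond_axioms cCp = {(vp \<^bold>\<rightarrow> vq) \<^bold>\<rightarrow> (\<^bold>\<not> vq \<^bold>\<rightarrow> \<^bold>\<not> vp)}"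
| "cond_axioms cWB = {((vp \<^bold>\<rightarrow> vq) \<^bold>\<and> (vq \<^bold>\<rightarrow> vr)) \<^bold>\<rightarrow> (vp \<^bold>\<rightarrow> vr)}"
| "cond_axioms cX = {vp \<^bold>\<or> \<^bold>\<not> vp}"
| "cond_axioms cRd = {(vp \<^bold>\<rightarrow> \<^bold>\<not> vp) \<^bold>\<rightarrow> \<^bold>\<not> vp}"
| "cond_axioms cB = {(vp \<^bold>\<rightarrow> vq) \<^bold>\<rightarrow> ((vr \<^bold>\<rightarrow> vp) \<^bold>\<rightarrow> (vr \<^bold>\<rightarrow> vq))}"
| "cond_axioms cCB = {(vp \<^bold>\<rightarrow> vq) \<^bold>\<rightarrow> ((vq \<^bold>\<rightarrow> vr) \<^bold>\<rightarrow> (vp \<^bold>\<rightarrow> vr))}"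
| "cond_axioms cW = {(vp \<^bold>\<rightarrow> (vp \<^bold>\<rightarrow> vq)) \<^bold>\<rightarrow> (vp \<^bold>\<rightarrow> vq)}"
| "cond_axioms cC = {(vp \<^bold>\<rightarrow> (vq \<^bold>\<rightarrow> vr)) \<^bold>\<rightarrow> (vq \<^bold>\<rightarrow> (vp \<^bold>\<rightarrow> vr))}"
| "cond_axioms cM = {vp \<^bold>\<rightarrow> (vp \<^bold>\<rightarrow> vp)}"
| "cond_axioms cER = {}"
| "cond_axioms cNec = {}"
| "cond_axioms cBoxK = {\<^bold>\<box> (vp \<^bold>\<rightarrow> vq) \<^bold>\<rightarrow> (\<^bold>\<box> vp \<^bold>\<rightarrow> \<^bold>\<box> vq)}"
| "cond_axioms cBoxT = {\<^bold>\<box> vp \<^bold>\<rightarrow> vp}"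
| "cond_axioms cBoxD = {\<^bold>\<box> (\<^bold>\<not> vp) \<^bold>\<rightarrow> \<^bold>\<not> (\<^bold>\<box> vp)}"
| "cond_axioms cBox4 = {\<^bold>\<box> vp \<^bold>\<rightarrow> \<^bold>\<box> (\<^bold>\<box> vp)}"
| "cond_axioms cBox5 = {\<^bold>\<not> (\<^bold>\<box> vp) \<^bold>\<rightarrow> \<^bold>\<box> (\<^bold>\<not> (\<^bold>\<box> vp))}"

definition cond_rules :: "cond \<Rightarrow> rule_set" where
  "cond_rules c =
     (if c = cER then {([\<phi>], (\<phi> \<^bold>\<rightarrow> \<psi>) \<^bold>\<rightarrow> \<psi>) | \<phi> \<psi>. True}
      else if c = cNec then {([\<phi>], \<^bold>\<box> \<phi>) | \<phi>. True}
      else {})"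

definition L_axioms :: "cond set \<Rightarrow> fm set" where
  "L_axioms \<Phi> = BMC_axioms \<union> (\<Union>c\<in>\<Phi>. cond_axioms c)"

definition L_rules :: "cond set \<Rightarrow> rule_set" where
  "L_rules \<Phi> = BMC_rules \<union> (\<Union>c\<in>\<Phi>. cond_rules c)"

primrec modal_free :: "fm \<Rightarrow> bool" where
  "modal_free (Var n) \<longleftrightarrow> True"
| "modal_free (\<^bold>\<not> \<phi>) \<longleftrightarrow> modal_free \<phi>"
| "modal_free (\<phi> \<^bold>\<and> \<psi>) \<longleftrightarrow> modal_free \<phi> \<and> modal_free \<psi>"
| "modal_free (\<phi> \<^bold>\<or> \<psi>) \<longleftrightarrow> modal_free \<phi> \<and> modal_free \<psi>"
| "modal_free (\<phi> \<^bold>\<rightarrow> \<psi>) \<longleftrightarrow> modal_free \<phi> \<and> modal_free \<psi>"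
| "modal_free (\<^bold>\<box> \<phi>) \<longleftrightarrow> False"
| "modal_free (\<^bold>\<box>\<^sub>L \<phi>) \<longleftrightarrow> False"

text \<open>The values on modal formulas are dummies: \<open>truth\<close> is only used on \<open>modal_free\<close> formulas.\<close>

primrec truth :: "(nat \<Rightarrow> bool) \<Rightarrow> fm \<Rightarrow> bool" where
  "truth h (Var n) \<longleftrightarrow> h n"
| "truth h (\<^bold>\<not> \<phi>) \<longleftrightarrow> \<not> truth h \<phi>"
| "truth h (\<phi> \<^bold>\<and> \<psi>) \<longleftrightarrow> truth h \<phi> \<and> truth h \<psi>"
| "truth h (\<phi> \<^bold>\<or> \<psi>) \<longleftrightarrow> truth h \<phi> \<or> truth h \<psi>"
| "truth h (\<phi> \<^bold>\<rightarrow> \<psi>) \<longleftrightarrow> (truth h \<phi> \<longrightarrow> truth h \<psi>)"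
| "truth h (\<^bold>\<box> \<phi>) \<longleftrightarrow> False"
| "truth h (\<^bold>\<box>\<^sub>L \<phi>) \<longleftrightarrow> False"

definition classical_tautology :: "fm \<Rightarrow> bool" where
  "classical_tautology \<phi> \<longleftrightarrow> modal_free \<phi> \<and> (\<forall>h. truth h \<phi>)"

inductive_set CL_theorems :: "cond set \<Rightarrow> fm set" for \<Phi> :: "cond set" where
  classical: "classical_tautology \<phi> \<Longrightarrow> subst \<sigma> \<phi> \<in> CL_theorems \<Phi>"
| modus_ponens: "\<phi> \<in> CL_theorems \<Phi> \<Longrightarrow> \<phi> \<^bold>\<rightarrow> \<psi> \<in> CL_theorems \<Phi> \<Longrightarrow> \<psi> \<in> CL_theorems \<Phi>"
| substitution: "\<phi> \<in> CL_theorems \<Phi> \<Longrightarrow> subst \<sigma> \<phi> \<in> CL_theorems \<Phi>"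
| L_axiom: "\<phi> \<in> L_axioms \<Phi> \<Longrightarrow> \<^bold>\<box>\<^sub>L \<phi> \<in> CL_theorems \<Phi>"
| L_rule: "(\<phi>s, \<psi>) \<in> L_rules \<Phi> \<Longrightarrow> (\<And>\<phi>. \<phi> \<in> set \<phi>s \<Longrightarrow> \<^bold>\<box>\<^sub>L \<phi> \<in> CL_theorems \<Phi>)
    \<Longrightarrow> \<^bold>\<box>\<^sub>L \<psi> \<in> CL_theorems \<Phi>"
| bridge: "\<^bold>\<box>\<^sub>L (\<phi> \<^bold>\<rightarrow> \<psi>) \<in> CL_theorems \<Phi> \<Longrightarrow> \<phi> \<^bold>\<rightarrow> \<psi> \<in> CL_theorems \<Phi>"

end

theory Submission
  imports Defs
begin

text \<open>Soundness rests on the two clauses of a W-frame: together they make \<open>\<box>\<^sub>L (\<phi> \<rightarrow> \<psi>)\<close> valid in a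
  model iff the extension of \<open>\<phi>\<close> is contained in that of \<open>\<psi>\<close>. For completeness, the points of the
  canonical frame are the prime theories, \<open>{}\<close> and \<open>UNIV\<close> included, of the logic
  \<open>{\<phi>. \<box>\<^sub>L \<phi> \<in> CL}\<close>, and its worlds are the proper nonempty prime theories of \<open>CL\<close> itself, i.e. the
  maximal consistent sets; by the Bridge Rule every world is a point. A point is \<open>Q\<^sub>L\<close>-accessible from
  some world iff it contains all \<open>\<phi>\<close> with \<open>\<box>\<^sub>L \<phi> \<in> CL\<close>, so the C-variants of the conditions reduce to
  the usual canonicity arguments for relevant logics.\<close>

section \<open>Soundness\<close>

text \<open>Two conditions do not match their axioms without double negation. \<open>cBoxD\<close>
  speaks of x* and x, while the axiom evaluated at x* leads to x**, so already soundness asks for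
  \<open>cDN\<close>. \<open>cRd\<close> is sound by itself, but in the canonical frame R s s* s
  amounts to the stronger law that (a -> b) entails (not a) or b, which is obtained from the axiom
  through double negation. In the absence of \<open>cDN\<close> the condition is instead inherited,
  on the frame itself, from \<open>cCp\<close>, \<open>cX\<close>, \<open>cC\<close> and
  \<open>cM\<close>. The theories \<open>{}\<close> and \<open>UNIV\<close> are kept as points for
  two reasons: they are the bounds 0 and 1 of the frame, and a prime theory found by an extension
  argument needs no proof of being nonempty or proper. Worlds must exclude both, since negation is
  not classical in them. Canonical points are sets of formulas, so frames over \<open>fm set\<close>
  suffice for completeness, while soundness holds for points of any type.\<close>

locale W_structure =
  fixes F :: "'s frame" and W :: "'s set"
  assumes W_frame: "W_frame F W"
begin

abbreviation L_points :: "'s set" where "L_points \<equiv> {s. \<exists>w\<in>W. (w, s) \<in> accL F}"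

lemma frame: "is_frame F"
  and bounded: "bounded_frame F"
  using W_frame by (auto simp: W_frame_def bounded_frame_def)

lemma ord_refl: "s \<in> pts F \<Longrightarrow> (s, s) \<in> ord F"
  and ord_antisym: "(s, t) \<in> ord F \<Longrightarrow> (t, s) \<in> ord F \<Longrightarrow> s = t"
  and ord_pts: "(s, t) \<in> ord F \<Longrightarrow> s \<in> pts F \<and> t \<in> pts F"
  and ter_pts: "(s, t, u) \<in> ter F \<Longrightarrow> s \<in> pts F \<and> t \<in> pts F \<and> u \<in> pts F"
  and ter_mono: "(s, t, u) \<in> ter F \<Longrightarrow> (s', s) \<in> ord F \<Longrightarrow> (t', t) \<in> ord F \<Longrightarrow> (u, u') \<in> ord F
    \<Longrightarrow> (s', t', u') \<in> ter F"
  and star_pts: "s \<in> pts F \<Longrightarrow> star F s \<in> pts F"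
  and star_antimono: "(s, t) \<in> ord F \<Longrightarrow> (star F t, star F s) \<in> ord F"
  and acc_pts: "(s, t) \<in> acc F \<Longrightarrow> s \<in> pts F \<and> t \<in> pts F"
  and acc_mono: "(s, t) \<in> acc F \<Longrightarrow> (s', s) \<in> ord F \<Longrightarrow> (t, t') \<in> ord F \<Longrightarrow> (s', t') \<in> acc F"
  and accL_pts: "(s, t) \<in> accL F \<Longrightarrow> s \<in> pts F \<and> t \<in> pts F"
  and accL_mono: "(s, t) \<in> accL F \<Longrightarrow> (s', s) \<in> ord F \<Longrightarrow> (t, t') \<in> ord F \<Longrightarrow> (s', t') \<in> accL F"
  using frame
  unfolding is_frame_def partial_order_on_def preorder_on_def
  by (auto dest: antisymD refl_onD)

lemma top_greatest: "is_greatest F (top_pt F)"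
proof -
  obtain z where "is_greatest F z" using bounded by (auto simp: bounded_frame_def)
  then show ?thesis
    unfolding top_pt_def using ord_antisym by (intro theI[of "is_greatest F"]) (auto simp: is_greatest_def)
qed

lemma top_pts: "top_pt F \<in> pts F"
  using top_greatest by (simp add: is_greatest_def)

lemma star_top: "star F (top_pt F) = bot_pt F"
  and star_bot: "star F (bot_pt F) = top_pt F"
  and acc_bot: "(bot_pt F, bot_pt F) \<in> acc F"
  and accL_bot: "(bot_pt F, bot_pt F) \<in> accL F"
  and acc_top: "(top_pt F, s) \<in> acc F \<Longrightarrow> s = top_pt F"
  and accL_top: "(top_pt F, s) \<in> accL F \<Longrightarrow> s = top_pt F"
  and ter_bot: "(bot_pt F, top_pt F, bot_pt F) \<in> ter F"
  and ter_top: "(top_pt F, s, t) \<in> ter F \<Longrightarrow> s = bot_pt F \<or> t = top_pt F"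
  using bounded unfolding bounded_frame_def by blast+

text \<open>The point \<open>u\<close> is a logical point with \<open>R u s s\<close>; the other triples follow from it by
  permutation, contraposition and \<open>u* \<le> u\<close>, and \<open>cM\<close> closes the loop.\<close>

lemma Rd_from_Cp_X_C_M:
  assumes Cp: "cond_holds F L_points cCp" and X: "cond_holds F L_points cX"
    and C: "cond_holds F L_points cC" and M: "cond_holds F L_points cM"
  shows "cond_holds F L_points cRd"
  unfolding cond_holds.simps
proof
  fix s assume s: "s \<in> pts F"
  have Cp': "(a, star F c, star F b) \<in> ter F" if "(a, b, c) \<in> ter F" for a b c
    using Cp that by simp
  have C': "\<exists>y. (a, d, y) \<in> ter F \<and> (y, b, e) \<in> ter F" if "(a, b, x) \<in> ter F" "(x, d, e) \<in> ter F" for a b x d e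
    using C[unfolded cond_holds.simps] that by blast
  have L: "(a, b) \<in> ord F" if "u \<in> L_points" "(u, a, b) \<in> ter F" for u a b
    using W_frame that unfolding W_frame_def by blast
  obtain u where u: "u \<in> L_points" "(u, s, s) \<in> ter F"
    using W_frame s unfolding W_frame_def by blast
  \<comment> \<open>C exchanges a and b in R v a a, R a b c; since v is logical, the resulting R v b
    y means b <= y, so y may be lowered to b.\<close>
  have comm: "(b, a, c) \<in> ter F" if *: "(a, b, c) \<in> ter F" for a b c
  proof -
    obtain v where v: "v \<in> L_points" "(v, a, a) \<in> ter F"
      using W_frame ter_pts[OF *] unfolding W_frame_def by blast
    then obtain y where "(v, b, y) \<in> ter F" "(y, a, c) \<in> ter F" using C'[OF v(2) *] by blast
    then show ?thesis using L[OF v(1)] ter_mono ord_refl ter_pts[OF *] by blast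
  qed
  have "(star F u, u) \<in> ord F" using X u(1) ter_pts[OF u(2)] by simp
  then have "(star F u, s, s) \<in> ter F" using ter_mono[OF u(2)] ord_refl s by blast
  moreover have "(s, star F s, star F u) \<in> ter F" by (rule Cp'[OF comm[OF u(2)]])
  \<comment> \<open>C swaps s* and s in R s s* u*, R u* s s. On R s s y both disjuncts of M read s
    <= y, so y may then be lowered to s.\<close>
  ultimately obtain y where y: "(s, s, y) \<in> ter F" "(y, star F s, s) \<in> ter F" using C' by blast
  then have "(s, y) \<in> ord F" using M by auto
  then show "(s, star F s, s) \<in> ter F" using ter_mono[OF y(2)] ord_refl s star_pts by blast
qed

end

section \<open>Truth in W-models and at possible worlds\<close>

locale W_model = W_structure F W for F :: "'s frame" and W :: "'s set" +
  fixes V :: "nat \<Rightarrow> 's set"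
  assumes W_valuation: "W_valuation F V"
begin

abbreviation E :: "fm \<Rightarrow> 's set" where "E \<equiv> ext F V"

text \<open>Each connective is covered by its own clauses of boundedness: 0* = 1 and 1* = 0 for
  negation, R010 and the restriction on R1st for implication, Q00 and the restriction on Q1s for the
  boxes. The bounds are carried along because \<open>world_Imp\<close> relies on 0 satisfying no
  formula and 1 satisfying all, and because \<open>W_valuation_subst\<close> needs extensions of
  formulas to be admissible values of variables.\<close>

lemma ext_admissible: "up_set F (E \<phi>) \<and> top_pt F \<in> E \<phi> \<and> bot_pt F \<notin> E \<phi>"
proof (induction \<phi>)
  case (Var n)
  then show ?case using W_valuation by (simp add: W_valuation_def)
next
  case (Neg \<phi>)
  then show ?case
    using star_antimono ord_pts star_top star_bot top_pts
    by (simp add: up_set_def) blast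
next
  case (Imp \<phi> \<psi>)
  have "up_set F (E (\<phi> \<^bold>\<rightarrow> \<psi>))"
    unfolding up_set_def using ter_mono ter_pts ord_pts ord_refl by (simp, blast)
  moreover have "top_pt F \<in> E (\<phi> \<^bold>\<rightarrow> \<psi>)"
    using Imp ter_top top_pts by auto
  moreover have "bot_pt F \<notin> E (\<phi> \<^bold>\<rightarrow> \<psi>)"
    using Imp ter_bot by auto
  ultimately show ?case by blast
next
  case (Box \<phi>)
  have "up_set F (E (\<^bold>\<box> \<phi>))"
    unfolding up_set_def using acc_mono acc_pts ord_pts ord_refl by (simp, blast)
  then show ?case
    using Box acc_bot acc_top top_pts by auto
next
  case (BoxL \<phi>)
  have "up_set F (E (\<^bold>\<box>\<^sub>L \<phi>))"
    unfolding up_set_def using accL_mono accL_pts ord_pts ord_refl by (simp, blast)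
  then show ?case
    using BoxL accL_bot accL_top top_pts by auto
qed (auto simp: up_set_def)

lemma ext_up: "s \<in> E \<phi> \<Longrightarrow> (s, t) \<in> ord F \<Longrightarrow> t \<in> E \<phi>"
  and ext_pts: "s \<in> E \<phi> \<Longrightarrow> s \<in> pts F"
  and ext_top: "top_pt F \<in> E \<phi>"
  and ext_bot: "bot_pt F \<notin> E \<phi>"
  using ext_admissible[of \<phi>] by (auto simp: up_set_def)

lemma W_pts: "w \<in> W \<Longrightarrow> w \<in> pts F"
  using W_frame by (auto simp: W_frame_def possible_world_def)

lemma world_Neg:
  assumes "w \<in> W" shows "w \<in> E (\<^bold>\<not> \<phi>) \<longleftrightarrow> w \<notin> E \<phi>"
  using assms W_frame by (auto simp: W_frame_def possible_world_def)

text \<open>R w w w gives one direction. For the other, let R w s t with the antecedent true at s.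
  Then s is not 0, so w <= t and a consequent true at w passes up to t; if instead the antecedent
  fails at w, then s <= w is impossible and t must be 1, where everything is true.\<close>

lemma world_Imp:
  assumes "w \<in> W" shows "w \<in> E (\<phi> \<^bold>\<rightarrow> \<psi>) \<longleftrightarrow> (w \<in> E \<phi> \<longrightarrow> w \<in> E \<psi>)"
proof -
  have "possible_world F w" using W_frame assms by (simp add: W_frame_def)
  moreover from this have "star F w = w" by (simp add: possible_world_def)
  ultimately have w: "w \<in> pts F" "(w, w, w) \<in> ter F"
    "(w, s, t) \<in> ter F \<Longrightarrow> s = bot_pt F \<or> (w, t) \<in> ord F"
    "(w, s, t) \<in> ter F \<Longrightarrow> t = top_pt F \<or> (s, w) \<in> ord F" for s t
    unfolding possible_world_def by simp_all
  show ?thesis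
  proof
    assume "w \<in> E (\<phi> \<^bold>\<rightarrow> \<psi>)"
    then show "w \<in> E \<phi> \<longrightarrow> w \<in> E \<psi>" using w(2) by auto
  next
    assume "w \<in> E \<phi> \<longrightarrow> w \<in> E \<psi>"
    moreover have "t \<in> E \<psi>" if "(w, s, t) \<in> ter F" "s \<in> E \<phi>" "w \<in> E \<psi>" for s t
      using that w(3) ext_bot ext_up by blast
    moreover have "t \<in> E \<psi>" if "(w, s, t) \<in> ter F" "s \<in> E \<phi>" "w \<notin> E \<phi>" for s t
      using that w(4) ext_top ext_up by blast
    ultimately show "w \<in> E (\<phi> \<^bold>\<rightarrow> \<psi>)" using w(1) by auto
  qed
qed

lemma world_truth:
  assumes "w \<in> W" "modal_free \<phi>"
  shows "w \<in> E \<phi> \<longleftrightarrow> truth (\<lambda>n. w \<in> V n) \<phi>"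
  using assms(2)
proof (induction \<phi>)
  case (Neg \<phi>)
  then show ?case using world_Neg[OF assms(1)] by simp
next
  case (Imp \<phi> \<psi>)
  then show ?case using world_Imp[OF assms(1), of \<phi> \<psi>] by (simp del: ext.simps)
qed auto

lemma valid_BoxL: "W \<subseteq> E (\<^bold>\<box>\<^sub>L \<phi>) \<longleftrightarrow> L_points \<subseteq> E \<phi>"
  using W_pts by auto

lemma valid_BoxL_Imp: "W \<subseteq> E (\<^bold>\<box>\<^sub>L (\<phi> \<^bold>\<rightarrow> \<psi>)) \<longleftrightarrow> E \<phi> \<subseteq> E \<psi>"
proof
  assume *: "W \<subseteq> E (\<^bold>\<box>\<^sub>L (\<phi> \<^bold>\<rightarrow> \<psi>))"
  show "E \<phi> \<subseteq> E \<psi>"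
  proof
    fix s assume s: "s \<in> E \<phi>"
    \<comment> \<open>Clause (b) of a W-frame supplies a logical point u with R u s s, so the
      implication true at u applies to s and returns s itself. The converse below rests on clause
      (a).\<close>
    then obtain w u where "w \<in> W" "(w, u) \<in> accL F" "(u, s, s) \<in> ter F"
      using W_frame ext_pts unfolding W_frame_def by blast
    with s * show "s \<in> E \<psi>" by auto
  qed
next
  assume "E \<phi> \<subseteq> E \<psi>"
  moreover have "(s, t) \<in> ord F" if "w \<in> W" "(w, u) \<in> accL F" "(u, s, t) \<in> ter F" for w u s t
    using that W_frame unfolding W_frame_def by blast
  ultimately show "W \<subseteq> E (\<^bold>\<box>\<^sub>L (\<phi> \<^bold>\<rightarrow> \<psi>))"
    using W_pts accL_pts ext_up by (simp, blast)
qed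

lemma L_points_Imp: "L_points \<subseteq> E (\<phi> \<^bold>\<rightarrow> \<psi>) \<longleftrightarrow> E \<phi> \<subseteq> E \<psi>"
  using valid_BoxL valid_BoxL_Imp by blast

section \<open>Soundness of the axioms and rules of L\<close>

lemma BMC_axiom_sound: "\<phi> \<in> BMC_axioms \<Longrightarrow> L_points \<subseteq> E \<phi>"
  unfolding BMC_axioms_def by (elim insertE emptyE; simp only: L_points_Imp; auto)

lemma Imp_D: "s \<in> E (\<phi> \<^bold>\<rightarrow> \<psi>) \<Longrightarrow> (s, t, u) \<in> ter F \<Longrightarrow> t \<in> E \<phi> \<Longrightarrow> u \<in> E \<psi>"
  and Box_D: "s \<in> E (\<^bold>\<box> \<phi>) \<Longrightarrow> (s, t) \<in> acc F \<Longrightarrow> t \<in> E \<phi>"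
  by auto

lemma Box_I: "s \<in> pts F \<Longrightarrow> (\<And>t. (s, t) \<in> acc F \<Longrightarrow> t \<in> E \<phi>) \<Longrightarrow> s \<in> E (\<^bold>\<box> \<phi>)"
  by auto

lemma cond_axiom_sound:
  assumes c: "cond_holds F L_points c" and DN: "c = cBoxD \<Longrightarrow> cond_holds F L_points cDN"
    and \<phi>: "\<phi> \<in> cond_axioms c"
  shows "L_points \<subseteq> E \<phi>"
proof (cases c)
  case cDN
  then have "E vp = E (\<^bold>\<not> (\<^bold>\<not> vp))" using c ext_pts[of _ vp] star_pts by auto
  then show ?thesis using cDN \<phi> L_points_Imp[of vp "\<^bold>\<not> (\<^bold>\<not> vp)"] L_points_Imp[of "\<^bold>\<not> (\<^bold>\<not> vp)" vp]
    by (simp add: Iff_def del: ext.simps(1,2,4-))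
next
  case cX
  then have "s \<in> E vp \<or> star F s \<notin> E vp" if "s \<in> L_points" for s
    using that c ext_up accL_pts cond_holds.simps(4)[of F L_points] by blast
  then show ?thesis using cX \<phi> accL_pts by auto
next
  case cCp
  have "E (vp \<^bold>\<rightarrow> vq) \<subseteq> E (\<^bold>\<not> vq \<^bold>\<rightarrow> \<^bold>\<not> vp)"
    using c cCp ter_pts by (simp, blast)
  then show ?thesis using cCp \<phi> L_points_Imp by (simp del: ext.simps)
next
  case cRd
  have "E (vp \<^bold>\<rightarrow> \<^bold>\<not> vp) \<subseteq> E (\<^bold>\<not> vp)"
    using c cRd by auto
  then show ?thesis using cRd \<phi> L_points_Imp by (simp del: ext.simps)
next
  case cWB
  have "E ((vp \<^bold>\<rightarrow> vq) \<^bold>\<and> (vq \<^bold>\<rightarrow> vr)) \<subseteq> E (vp \<^bold>\<rightarrow> vr)"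
    using c cWB by (simp, blast)
  then show ?thesis using cWB \<phi> L_points_Imp by (simp del: ext.simps)
next
  case cB
  have "E (vp \<^bold>\<rightarrow> vq) \<subseteq> E ((vr \<^bold>\<rightarrow> vp) \<^bold>\<rightarrow> (vr \<^bold>\<rightarrow> vq))"
    using c cB ter_pts by (simp, blast)
  then show ?thesis using cB \<phi> L_points_Imp by (simp del: ext.simps)
next
  case cCB
  have "E (vp \<^bold>\<rightarrow> vq) \<subseteq> E ((vq \<^bold>\<rightarrow> vr) \<^bold>\<rightarrow> (vp \<^bold>\<rightarrow> vr))"
    using c cCB ter_pts by (simp, blast)
  then show ?thesis using cCB \<phi> L_points_Imp by (simp del: ext.simps)
next
  case cW
  have "E (vp \<^bold>\<rightarrow> (vp \<^bold>\<rightarrow> vq)) \<subseteq> E (vp \<^bold>\<rightarrow> vq)"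
    using c cW ter_pts by (simp, blast)
  then show ?thesis using cW \<phi> L_points_Imp by (simp del: ext.simps)
next
  case cC
  have "E (vp \<^bold>\<rightarrow> (vq \<^bold>\<rightarrow> vr)) \<subseteq> E (vq \<^bold>\<rightarrow> (vp \<^bold>\<rightarrow> vr))"
    using c cC ter_pts by (simp, blast)
  then show ?thesis using cC \<phi> L_points_Imp by (simp del: ext.simps)
next
  case cM
  have "E vp \<subseteq> E (vp \<^bold>\<rightarrow> vp)"
    using c cM ext_pts[of _ vp] ext_up[of _ vp] by (simp, blast)
  then show ?thesis using cM \<phi> L_points_Imp by (simp del: ext.simps)
next
  case cBoxK
  have "E (\<^bold>\<box> (vp \<^bold>\<rightarrow> vq)) \<subseteq> E (\<^bold>\<box> vp \<^bold>\<rightarrow> \<^bold>\<box> vq)"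
    using c cBoxK ter_pts by (simp, blast)
  then show ?thesis using cBoxK \<phi> L_points_Imp by (simp del: ext.simps)
next
  case cBoxT
  have "E (\<^bold>\<box> vp) \<subseteq> E vp"
    using c cBoxT by auto
  then show ?thesis using cBoxT \<phi> L_points_Imp by (simp del: ext.simps)
next
  case cBoxD
  have "E (\<^bold>\<box> (\<^bold>\<not> vp)) \<subseteq> E (\<^bold>\<not> (\<^bold>\<box> vp))"
  proof
    fix s assume s: "s \<in> E (\<^bold>\<box> (\<^bold>\<not> vp))"
    then obtain x where x: "x \<in> pts F" "(s, star F x) \<in> acc F" "(star F s, x) \<in> acc F"
      using c cBoxD by auto
    \<comment> \<open>That s sees x* refutes the variable only at x**; \<open>DN\<close> moves this
      to x, the point seen from s*.\<close>
    then have "star F (star F x) \<notin> E vp" using s by auto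
    then have "x \<notin> E vp" using DN cBoxD x(1) by simp
    then show "s \<in> E (\<^bold>\<not> (\<^bold>\<box> vp))" using s x(3) by auto
  qed
  then show ?thesis using cBoxD \<phi> L_points_Imp by (simp del: ext.simps)
next
  case cBox4
  have "E (\<^bold>\<box> vp) \<subseteq> E (\<^bold>\<box> (\<^bold>\<box> vp))"
  proof
    fix s assume s: "s \<in> E (\<^bold>\<box> vp)"
    have "u \<in> E vp" if "(s, t) \<in> acc F" "(t, u) \<in> acc F" for t u
      using that c cBox4 Box_D[OF s] cond_holds.simps(16)[of F L_points] by blast
    then show "s \<in> E (\<^bold>\<box> (\<^bold>\<box> vp))" using acc_pts ext_pts[OF s] by (blast intro: Box_I)
  qed
  then show ?thesis using cBox4 \<phi> L_points_Imp by (simp del: ext.simps)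
next
  case cBox5
  have "E (\<^bold>\<not> (\<^bold>\<box> vp)) \<subseteq> E (\<^bold>\<box> (\<^bold>\<not> (\<^bold>\<box> vp)))"
  proof
    fix s assume s: "s \<in> E (\<^bold>\<not> (\<^bold>\<box> vp))"
    then obtain u where u: "(star F s, u) \<in> acc F" "u \<notin> E vp"
      using star_pts by auto
    have "t \<in> E (\<^bold>\<not> (\<^bold>\<box> vp))" if "(s, t) \<in> acc F" for t
    proof -
      have "(star F t, u) \<in> acc F" using c cBox5 u(1) that ext_pts[OF s] by simp
      then show ?thesis using u(2) that acc_pts by auto
    qed
    then show "s \<in> E (\<^bold>\<box> (\<^bold>\<not> (\<^bold>\<box> vp)))" using ext_pts[OF s] by (blast intro: Box_I)
  qed
  then show ?thesis using cBox5 \<phi> L_points_Imp by (simp del: ext.simps)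
\<comment> \<open>\<open>cER\<close> and \<open>cNec\<close> contribute rules and have an empty set
  of axioms.\<close>
qed (use \<phi> in auto)

lemma cond_rule_sound:
  assumes "cond_holds F L_points c" "(\<phi>s, \<psi>) \<in> cond_rules c" "\<And>\<phi>. \<phi> \<in> set \<phi>s \<Longrightarrow> L_points \<subseteq> E \<phi>"
  shows "L_points \<subseteq> E \<psi>"
proof -
  consider (ER) \<phi> \<chi> where "c = cER" "\<phi>s = [\<phi>]" "\<psi> = (\<phi> \<^bold>\<rightarrow> \<chi>) \<^bold>\<rightarrow> \<chi>"
    | (Nec) \<phi> where "c = cNec" "\<phi>s = [\<phi>]" "\<psi> = \<^bold>\<box> \<phi>"
    using assms(2) by (auto simp: cond_rules_def split: if_splits)
  then show ?thesis
  proof cases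
    case ER
    have "E (\<phi> \<^bold>\<rightarrow> \<chi>) \<subseteq> E \<chi>"
    proof
      fix s assume s: "s \<in> E (\<phi> \<^bold>\<rightarrow> \<chi>)"
      then obtain x where "x \<in> L_points" "(s, x, s) \<in> ter F"
        using assms(1) ER ext_pts[OF s] by (simp del: ext.simps) blast
      then show "s \<in> E \<chi>" using Imp_D[OF s, of x s] ER(2) assms(3) by auto
    qed
    then show ?thesis using ER L_points_Imp by blast
  next
    case Nec
    have "x \<in> E (\<^bold>\<box> \<phi>)" if x: "x \<in> L_points" for x
    proof (rule Box_I)
      show "x \<in> pts F" using x accL_pts by auto
      fix t assume "(x, t) \<in> acc F"
      then have "t \<in> L_points" using x assms(1) Nec by auto
      then show "t \<in> E \<phi>" using assms(3) Nec by auto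
    qed
    then show ?thesis using Nec by blast
  qed
qed

end

section \<open>Soundness of CL\<close>

lemma ext_subst: "ext F V (subst \<sigma> \<phi>) = ext F (\<lambda>n. ext F V (\<sigma> n)) \<phi>"
  by (induction \<phi>) simp_all

lemma W_valuation_subst:
  assumes "W_frame F W" "W_valuation F V"
  shows "W_valuation F (\<lambda>n. ext F V (\<sigma> n))"
proof -
  interpret W_model F W V using assms by unfold_locales
  show ?thesis using ext_admissible by (simp add: W_valuation_def)
qed

lemma CL_sound:
  assumes DN: "cBoxD \<in> \<Phi> \<longrightarrow> cDN \<in> \<Phi>" and "CL_frame \<Phi> F W" and "\<phi> \<in> CL_theorems \<Phi>"
  shows "valid_in_frame F W \<phi>"
  unfolding valid_in_frame_def
proof (intro allI impI)
  fix V assume V: "W_valuation F V"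
  have F: "W_frame F W" and conds: "\<And>c. c \<in> \<Phi> \<Longrightarrow> cond_holds F {s. \<exists>w\<in>W. (w, s) \<in> accL F} c"
    using assms(2) by (auto simp: CL_frame_def)
  have M: "W_model F W V" if "W_valuation F V" for V
    using F that by unfold_locales
  show "W \<subseteq> ext F V \<phi>"
    using assms(3) V
  \<comment> \<open>The valuation must vary: substitution, both as a rule of CL and boxed as a rule
    of L, is checked by passing to the substituted valuation.\<close>
  proof (induction arbitrary: V)
    case (classical \<phi> \<sigma>)
    interpret W_model F W "\<lambda>n. ext F V (\<sigma> n)"
      using M W_valuation_subst[OF F] classical by blast
    show ?case using classical world_truth by (auto simp: ext_subst classical_tautology_def)
  next
    case (modus_ponens \<phi> \<psi>)
    interpret W_model F W V using M modus_ponens by blast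
    show ?case using modus_ponens world_Imp by blast
  next
    case (substitution \<phi> \<sigma>)
    then show ?case using W_valuation_subst[OF F] by (simp add: ext_subst)
  next
    case (L_axiom \<phi>)
    interpret W_model F W V using M L_axiom by blast
    show ?case
      using L_axiom(1) BMC_axiom_sound cond_axiom_sound conds DN
      unfolding valid_BoxL L_axioms_def by blast
  next
    case (L_rule \<phi>s \<psi>)
    interpret W_model F W V using M L_rule by blast
    have IH: "L_points \<subseteq> ext F V \<phi>" if "\<phi> \<in> set \<phi>s" "W_valuation F V" for \<phi> V
      using L_rule(3)[OF that] W_model.valid_BoxL[OF M[OF that(2)]] by blast
    note IH' = IH[OF _ W_valuation]
    have "L_points \<subseteq> E \<psi>"
    proof (cases "(\<phi>s, \<psi>) \<in> BMC_rules")
      case False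
      then show ?thesis using L_rule(1) cond_rule_sound conds IH' unfolding L_rules_def by blast
    next
      case True
      then show ?thesis
      proof cases
        case (substitution \<phi> \<sigma>)
        then show ?thesis using IH[OF _ W_valuation_subst[OF F W_valuation]] by (simp add: ext_subst)
      next
        case (modus_ponens \<phi>)
        then show ?thesis using IH'[of \<phi>] IH'[of "\<phi> \<^bold>\<rightarrow> \<psi>"] L_points_Imp[of \<phi> \<psi>]
          by (simp del: ext.simps)
      next
        case (adjunction \<phi> \<chi>)
        then show ?thesis using IH'[of \<phi>] IH'[of \<chi>] by auto
      next
        case (affixing \<phi>' \<phi> \<chi> \<chi>')
        then have "E \<phi>' \<subseteq> E \<phi>" "E \<chi> \<subseteq> E \<chi>'"
          using IH' unfolding L_points_Imp[symmetric] by (simp_all del: ext.simps)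
        then have "E (\<phi> \<^bold>\<rightarrow> \<chi>) \<subseteq> E (\<phi>' \<^bold>\<rightarrow> \<chi>')" by auto
        then show ?thesis using affixing L_points_Imp by blast
      next
        case (contraposition \<phi> \<chi>)
        then have "E \<phi> \<subseteq> E \<chi>" using IH' unfolding L_points_Imp[symmetric] by (simp del: ext.simps)
        then have "E (\<^bold>\<not> \<chi>) \<subseteq> E (\<^bold>\<not> \<phi>)" by auto
        then show ?thesis using contraposition L_points_Imp by blast
      next
        case (Box_mono \<phi> \<chi>)
        then have "E \<phi> \<subseteq> E \<chi>" using IH' unfolding L_points_Imp[symmetric] by (simp del: ext.simps)
        then have "E (\<^bold>\<box> \<phi>) \<subseteq> E (\<^bold>\<box> \<chi>)" by auto
        then show ?thesis using Box_mono L_points_Imp by blast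
      next
        case (BoxL_mono \<phi> \<chi>)
        then have "E \<phi> \<subseteq> E \<chi>" using IH' unfolding L_points_Imp[symmetric] by (simp del: ext.simps)
        then have "E (\<^bold>\<box>\<^sub>L \<phi>) \<subseteq> E (\<^bold>\<box>\<^sub>L \<chi>)" by auto
        then show ?thesis using BoxL_mono L_points_Imp by blast
      qed
    qed
    then show ?case using valid_BoxL by blast
  next
    case (bridge \<phi> \<psi>)
    interpret W_model F W V using M bridge by blast
    have "E \<phi> \<subseteq> E \<psi>" using bridge valid_BoxL_Imp by blast
    then show ?case using world_Imp by blast
  qed
qed

corollary soundness:
  assumes "cBoxD \<in> \<Phi> \<longrightarrow> cDN \<in> \<Phi>"
  shows "CL_theorems \<Phi> \<subseteq> CL_logic TYPE('s) \<Phi>"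
  using CL_sound[OF assms] by (auto simp: CL_logic_def)

section \<open>Prime theories\<close>

text \<open>Only the laws of a distributive lattice are asked for, so one prime filter theorem
  serves both classical provability \<open>entC\<close> and relevant provability
  \<open>entL\<close>. No top or bottom formula is assumed, and theories may be empty or
  improper.\<close>

locale entailment =
  fixes ent :: "fm \<Rightarrow> fm \<Rightarrow> bool"
  assumes refl: "ent a a"
    and trans: "ent a b \<Longrightarrow> ent b c \<Longrightarrow> ent a c"
    and And_left: "ent (a \<^bold>\<and> b) a"
    and And_right: "ent (a \<^bold>\<and> b) b"
    and And_intro: "ent c a \<Longrightarrow> ent c b \<Longrightarrow> ent c (a \<^bold>\<and> b)"
    and Or_left: "ent a (a \<^bold>\<or> b)"
    and Or_right: "ent b (a \<^bold>\<or> b)"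
    and Or_elim: "ent a c \<Longrightarrow> ent b c \<Longrightarrow> ent (a \<^bold>\<or> b) c"
    and distrib: "ent (a \<^bold>\<and> (b \<^bold>\<or> c)) ((a \<^bold>\<and> b) \<^bold>\<or> (a \<^bold>\<and> c))"
begin

definition is_theory :: "fm set \<Rightarrow> bool" where
  "is_theory T \<longleftrightarrow> (\<forall>a b. a \<in> T \<longrightarrow> ent a b \<longrightarrow> b \<in> T) \<and> (\<forall>a b. a \<in> T \<longrightarrow> b \<in> T \<longrightarrow> a \<^bold>\<and> b \<in> T)"

definition prime :: "fm set \<Rightarrow> bool" where
  "prime T \<longleftrightarrow> is_theory T \<and> (\<forall>a b. a \<^bold>\<or> b \<in> T \<longrightarrow> a \<in> T \<or> b \<in> T)"

text \<open>Stands in for an ideal. Downward closure is not demanded, because a theory that avoids D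
  also avoids everything entailing a member of D; sets of formulas of one fixed shape, such as
  implications or boxed formulas, can therefore be used directly.\<close>

definition directed :: "fm set \<Rightarrow> bool" where
  "directed D \<longleftrightarrow> (\<forall>a\<in>D. \<forall>b\<in>D. \<exists>c\<in>D. ent (a \<^bold>\<or> b) c)"

lemma theoryI: "(\<And>a b. a \<in> T \<Longrightarrow> ent a b \<Longrightarrow> b \<in> T) \<Longrightarrow> (\<And>a b. a \<in> T \<Longrightarrow> b \<in> T \<Longrightarrow> a \<^bold>\<and> b \<in> T) \<Longrightarrow> is_theory T"
  and theory_closed: "is_theory T \<Longrightarrow> ent a b \<Longrightarrow> a \<in> T \<Longrightarrow> b \<in> T"
  and theory_And: "is_theory T \<Longrightarrow> a \<in> T \<Longrightarrow> b \<in> T \<Longrightarrow> a \<^bold>\<and> b \<in> T"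
  by (auto simp: is_theory_def)

lemma theory_closed2: "is_theory T \<Longrightarrow> ent (a \<^bold>\<and> b) c \<Longrightarrow> a \<in> T \<Longrightarrow> b \<in> T \<Longrightarrow> c \<in> T"
  using theory_closed theory_And by blast

lemma primeI: "is_theory T \<Longrightarrow> (\<And>a b. a \<^bold>\<or> b \<in> T \<Longrightarrow> a \<in> T \<or> b \<in> T) \<Longrightarrow> prime T"
  and prime_theory: "prime T \<Longrightarrow> is_theory T"
  and prime_Or: "prime T \<Longrightarrow> a \<^bold>\<or> b \<in> T \<Longrightarrow> a \<in> T \<or> b \<in> T"
  by (auto simp: prime_def)

lemma prime_And_iff: "prime T \<Longrightarrow> a \<^bold>\<and> b \<in> T \<longleftrightarrow> a \<in> T \<and> b \<in> T"
  using prime_theory theory_And theory_closed And_left And_right by blast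

lemma prime_Or_iff: "prime T \<Longrightarrow> a \<^bold>\<or> b \<in> T \<longleftrightarrow> a \<in> T \<or> b \<in> T"
  using prime_theory prime_Or theory_closed Or_left Or_right by blast

lemma prime_empty: "prime {}" and prime_UNIV: "prime UNIV"
  by (auto simp: prime_def is_theory_def)

lemma directedI: "(\<And>a b. a \<in> D \<Longrightarrow> b \<in> D \<Longrightarrow> \<exists>c\<in>D. ent (a \<^bold>\<or> b) c) \<Longrightarrow> directed D"
  by (simp add: directed_def)

lemma And_mono: "ent a a' \<Longrightarrow> ent b b' \<Longrightarrow> ent (a \<^bold>\<and> b) (a' \<^bold>\<and> b')"
  by (blast intro: And_intro trans And_left And_right)

lemma Or_mono: "ent a a' \<Longrightarrow> ent b b' \<Longrightarrow> ent (a \<^bold>\<or> b) (a' \<^bold>\<or> b')"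
  by (blast intro: Or_elim trans Or_left Or_right)

text \<open>This is the theory generated by M and a. A member of M is required because from an empty
  M the construction stays empty and misses a.\<close>

lemma theory_adjoin:
  assumes M: "is_theory M" and m: "m \<in> M"
  shows "is_theory {x. \<exists>m\<in>M. ent (m \<^bold>\<and> a) x}" (is "is_theory ?T")
    and "M \<subseteq> {x. \<exists>m\<in>M. ent (m \<^bold>\<and> a) x}" and "a \<in> {x. \<exists>m\<in>M. ent (m \<^bold>\<and> a) x}"
proof -
  show "is_theory ?T"
  proof (rule theoryI)
    fix x y assume "x \<in> ?T" "y \<in> ?T"
    then obtain m m' where *: "m \<in> M" "m' \<in> M" "ent (m \<^bold>\<and> a) x" "ent (m' \<^bold>\<and> a) y" by blast
    have "ent ((m \<^bold>\<and> m') \<^bold>\<and> a) (m \<^bold>\<and> a)" "ent ((m \<^bold>\<and> m') \<^bold>\<and> a) (m' \<^bold>\<and> a)"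
      by (rule And_mono, rule And_left And_right, rule refl)+
    then have "ent ((m \<^bold>\<and> m') \<^bold>\<and> a) (x \<^bold>\<and> y)" using * And_intro trans by blast
    then show "x \<^bold>\<and> y \<in> ?T" using * theory_And[OF M] by blast
  qed (blast intro: trans)
  show "M \<subseteq> ?T" using And_left by blast
  show "a \<in> ?T" using m And_right by blast
qed

text \<open>Prime filter theorem. Zorn gives a maximal theory disjoint from D. If it contained a
  disjunction but neither disjunct, adjoining either one would hit D, and directedness together with
  distributivity would place a member of D in it.\<close>

lemma prime_extension:
  assumes T: "is_theory T" and D: "directed D" and disj: "T \<inter> D = {}"
  obtains P where "prime P" "T \<subseteq> P" "P \<inter> D = {}"
proof -
  let ?A = "{M. is_theory M \<and> T \<subseteq> M \<and> M \<inter> D = {}}"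
  have "\<exists>M\<in>?A. \<forall>X\<in>?A. M \<subseteq> X \<longrightarrow> X = M"
  proof (rule subset_Zorn_nonempty)
    show "?A \<noteq> {}" using T disj by blast
    fix C assume C: "C \<noteq> {}" "subset.chain ?A C"
    then have sub: "C \<subseteq> ?A" and lin: "\<And>X Y. X \<in> C \<Longrightarrow> Y \<in> C \<Longrightarrow> X \<subseteq> Y \<or> Y \<subseteq> X"
      by (auto simp: subset_chain_def)
    have C_th: "is_theory X" if "X \<in> C" for X using sub that by blast
    have "is_theory (\<Union>C)"
    proof (rule theoryI)
      fix a b assume "a \<in> \<Union>C" "b \<in> \<Union>C"
      then obtain X Y where XY: "X \<in> C" "Y \<in> C" "a \<in> X" "b \<in> Y" by blast
      then obtain Z where "Z \<in> C" "a \<in> Z" "b \<in> Z" using lin[of X Y] by blast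
      then show "a \<^bold>\<and> b \<in> \<Union>C" using C_th theory_And by blast
    qed (use C_th theory_closed in blast)
    then show "\<Union>C \<in> ?A" using C(1) sub by blast
  qed
  then obtain M where M': "M \<in> ?A" and M_max: "\<forall>X\<in>?A. M \<subseteq> X \<longrightarrow> X = M" ..
  from M' have M: "is_theory M" "T \<subseteq> M" "M \<inter> D = {}" by simp_all
  have max: "X = M" if "is_theory X" "M \<subseteq> X" "X \<inter> D = {}" for X
    using M_max[rule_format, of X] that M(2) by simp
  have "prime M"
  proof (rule primeI[OF M(1)], rule ccontr)
    fix a b assume ab: "a \<^bold>\<or> b \<in> M" and "\<not> (a \<in> M \<or> b \<in> M)"
    then have no: "a \<notin> M" "b \<notin> M" by auto
    \<comment> \<open>The disjunction in M is the member that \<open>theory_adjoin\<close> asks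
      for.\<close>
    have hits: "\<exists>m\<in>M. \<exists>d\<in>D. ent (m \<^bold>\<and> c) d" if "c \<notin> M" for c
      using max[OF theory_adjoin(1,2)[OF M(1) ab, of c]] theory_adjoin(3)[OF M(1) ab, of c] that by blast
    obtain m d where md: "m \<in> M" "d \<in> D" "ent (m \<^bold>\<and> a) d" using hits[OF no(1)] by blast
    obtain m' d' where md': "m' \<in> M" "d' \<in> D" "ent (m' \<^bold>\<and> b) d'" using hits[OF no(2)] by blast
    obtain e where e: "e \<in> D" "ent (d \<^bold>\<or> d') e" using D md(2) md'(2) by (auto simp: directed_def)
    have "ent ((m \<^bold>\<and> m') \<^bold>\<and> a) d" "ent ((m \<^bold>\<and> m') \<^bold>\<and> b) d'"
      using md(3) md'(3) And_mono And_left And_right refl trans by meson+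
    from trans[OF distrib trans[OF Or_mono[OF this] e(2)]]
    have "ent ((m \<^bold>\<and> m') \<^bold>\<and> (a \<^bold>\<or> b)) e" .
    then have "e \<in> M" using theory_closed2[OF M(1)] theory_And[OF M(1) md(1) md'(1)] ab by blast
    then show False using e(1) M(3) by blast
  qed
  then show thesis using that M by blast
qed

end

section \<open>Derivability\<close>

locale CL_system =
  fixes \<Phi> :: "cond set"
begin

abbreviation CL_thm :: "fm \<Rightarrow> bool" where "CL_thm a \<equiv> a \<in> CL_theorems \<Phi>"
abbreviation L_thm :: "fm \<Rightarrow> bool" where "L_thm a \<equiv> CL_thm (\<^bold>\<box>\<^sub>L a)"
abbreviation entC :: "fm \<Rightarrow> fm \<Rightarrow> bool" where "entC a b \<equiv> CL_thm (a \<^bold>\<rightarrow> b)"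
abbreviation entL :: "fm \<Rightarrow> fm \<Rightarrow> bool" where "entL a b \<equiv> L_thm (a \<^bold>\<rightarrow> b)"

text \<open>The axioms and the tautologies in use contain at most the variables 0, 1 and 2, so the
  value at larger indices is arbitrary.\<close>

definition inst3 :: "fm \<Rightarrow> fm \<Rightarrow> fm \<Rightarrow> nat \<Rightarrow> fm" where
  "inst3 a b c n = (if n = 0 then a else if n = 1 then b else c)"

lemma tautology: "classical_tautology \<phi> \<Longrightarrow> subst (inst3 a b c) \<phi> = \<psi> \<Longrightarrow> CL_thm \<psi>"
  using CL_theorems.classical by blast

lemmas tautology_simps = classical_tautology_def inst3_def

lemma CL_mp: "CL_thm a \<Longrightarrow> entC a b \<Longrightarrow> CL_thm b"
  by (rule CL_theorems.modus_ponens)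

sublocale C: entailment entC
proof
  fix a b c
  show "entC a a"
    by (rule tautology[of "vp \<^bold>\<rightarrow> vp" a a a]) (simp_all add: tautology_simps)
  have "CL_thm ((a \<^bold>\<rightarrow> b) \<^bold>\<rightarrow> ((b \<^bold>\<rightarrow> c) \<^bold>\<rightarrow> (a \<^bold>\<rightarrow> c)))"
    by (rule tautology[of "(vp \<^bold>\<rightarrow> vq) \<^bold>\<rightarrow> ((vq \<^bold>\<rightarrow> vr) \<^bold>\<rightarrow> (vp \<^bold>\<rightarrow> vr))" a b c])
      (simp_all add: tautology_simps)
  then show "entC a b \<Longrightarrow> entC b c \<Longrightarrow> entC a c" using CL_mp by blast
  show "entC (a \<^bold>\<and> b) a"
    by (rule tautology[of "(vp \<^bold>\<and> vq) \<^bold>\<rightarrow> vp" a b b]) (simp_all add: tautology_simps)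
  show "entC (a \<^bold>\<and> b) b"
    by (rule tautology[of "(vp \<^bold>\<and> vq) \<^bold>\<rightarrow> vq" a b b]) (simp_all add: tautology_simps)
  show "entC a (a \<^bold>\<or> b)"
    by (rule tautology[of "vp \<^bold>\<rightarrow> (vp \<^bold>\<or> vq)" a b b]) (simp_all add: tautology_simps)
  show "entC b (a \<^bold>\<or> b)"
    by (rule tautology[of "vq \<^bold>\<rightarrow> (vp \<^bold>\<or> vq)" a b b]) (simp_all add: tautology_simps)
  have "CL_thm ((c \<^bold>\<rightarrow> a) \<^bold>\<rightarrow> ((c \<^bold>\<rightarrow> b) \<^bold>\<rightarrow> (c \<^bold>\<rightarrow> (a \<^bold>\<and> b))))"
    by (rule tautology[of "(vr \<^bold>\<rightarrow> vp) \<^bold>\<rightarrow> ((vr \<^bold>\<rightarrow> vq) \<^bold>\<rightarrow> (vr \<^bold>\<rightarrow> (vp \<^bold>\<and> vq)))" a b c])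
      (simp_all add: tautology_simps)
  then show "entC c a \<Longrightarrow> entC c b \<Longrightarrow> entC c (a \<^bold>\<and> b)" using CL_mp by blast
  have "CL_thm ((a \<^bold>\<rightarrow> c) \<^bold>\<rightarrow> ((b \<^bold>\<rightarrow> c) \<^bold>\<rightarrow> ((a \<^bold>\<or> b) \<^bold>\<rightarrow> c)))"
    by (rule tautology[of "(vp \<^bold>\<rightarrow> vr) \<^bold>\<rightarrow> ((vq \<^bold>\<rightarrow> vr) \<^bold>\<rightarrow> ((vp \<^bold>\<or> vq) \<^bold>\<rightarrow> vr))" a b c])
      (simp_all add: tautology_simps)
  then show "entC a c \<Longrightarrow> entC b c \<Longrightarrow> entC (a \<^bold>\<or> b) c" using CL_mp by blast
  show "entC (a \<^bold>\<and> (b \<^bold>\<or> c)) ((a \<^bold>\<and> b) \<^bold>\<or> (a \<^bold>\<and> c))"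
    by (rule tautology[of "(vp \<^bold>\<and> (vq \<^bold>\<or> vr)) \<^bold>\<rightarrow> ((vp \<^bold>\<and> vq) \<^bold>\<or> (vp \<^bold>\<and> vr))" a b c])
      (simp_all add: tautology_simps)
qed

lemma entC_excluded_middle: "entC a (b \<^bold>\<or> \<^bold>\<not> b)"
  by (rule tautology[of "vp \<^bold>\<rightarrow> (vq \<^bold>\<or> \<^bold>\<not> vq)" a b b]) (simp_all add: tautology_simps)

lemma entC_contradiction: "entC (a \<^bold>\<and> \<^bold>\<not> a) b"
  by (rule tautology[of "(vp \<^bold>\<and> \<^bold>\<not> vp) \<^bold>\<rightarrow> vq" a b b]) (simp_all add: tautology_simps)

lemma entC_mp: "entC ((a \<^bold>\<rightarrow> b) \<^bold>\<and> a) b"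
  by (rule tautology[of "((vp \<^bold>\<rightarrow> vq) \<^bold>\<and> vp) \<^bold>\<rightarrow> vq" a b b]) (simp_all add: tautology_simps)

lemma entC_weaken: "entC a (b \<^bold>\<rightarrow> a)"
  by (rule tautology[of "vp \<^bold>\<rightarrow> (vq \<^bold>\<rightarrow> vp)" a b b]) (simp_all add: tautology_simps)

lemma entC_efq: "entC (\<^bold>\<not> a) (a \<^bold>\<rightarrow> b)"
  by (rule tautology[of "\<^bold>\<not> vp \<^bold>\<rightarrow> (vp \<^bold>\<rightarrow> vq)" a b b]) (simp_all add: tautology_simps)

lemma entC_theorem: "CL_thm b \<Longrightarrow> entC a b"
  using entC_weaken CL_mp by blast

lemma L_rule1: "([a], b) \<in> L_rules \<Phi> \<Longrightarrow> L_thm a \<Longrightarrow> L_thm b"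
  using CL_theorems.L_rule[of "[a]" b \<Phi>] by simp

lemma L_rule2: "([a, b], c) \<in> L_rules \<Phi> \<Longrightarrow> L_thm a \<Longrightarrow> L_thm b \<Longrightarrow> L_thm c"
  using CL_theorems.L_rule[of "[a, b]" c \<Phi>] by auto

lemma BMC_L_rules: "r \<in> BMC_rules \<Longrightarrow> r \<in> L_rules \<Phi>"
  by (simp add: L_rules_def)

lemma L_mp: "L_thm a \<Longrightarrow> entL a b \<Longrightarrow> L_thm b"
  and L_adj: "L_thm a \<Longrightarrow> L_thm b \<Longrightarrow> L_thm (a \<^bold>\<and> b)"
  and Imp_mono: "entL a' a \<Longrightarrow> entL b b' \<Longrightarrow> entL (a \<^bold>\<rightarrow> b) (a' \<^bold>\<rightarrow> b')"
  and Neg_antimono: "entL a b \<Longrightarrow> entL (\<^bold>\<not> b) (\<^bold>\<not> a)"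
  and Box_mono: "entL a b \<Longrightarrow> entL (\<^bold>\<box> a) (\<^bold>\<box> b)"
  and BoxL_mono: "entL a b \<Longrightarrow> entL (\<^bold>\<box>\<^sub>L a) (\<^bold>\<box>\<^sub>L b)"
  by (auto intro: L_rule1 L_rule2 BMC_L_rules BMC_rules.intros)

lemma L_instance: "\<phi> \<in> L_axioms \<Phi> \<Longrightarrow> subst \<sigma> \<phi> = \<psi> \<Longrightarrow> L_thm \<psi>"
  using L_rule1[OF BMC_L_rules[OF BMC_rules.substitution]] CL_theorems.L_axiom by blast

lemma BMC_instances: "\<forall>\<phi>\<in>BMC_axioms. L_thm (subst (inst3 a b c) \<phi>)"
  using L_instance by (auto simp: L_axioms_def)

lemma cond_instance: "k \<in> \<Phi> \<Longrightarrow> \<phi> \<in> cond_axioms k \<Longrightarrow> subst (inst3 a b c) \<phi> = \<psi> \<Longrightarrow> L_thm \<psi>"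
  using L_instance by (auto simp: L_axioms_def)

lemma L_refl: "entL a a"
  and L_Neg_And: "entL (\<^bold>\<not> (a \<^bold>\<and> b)) (\<^bold>\<not> a \<^bold>\<or> \<^bold>\<not> b)"
  and L_Neg_Or: "entL (\<^bold>\<not> a \<^bold>\<and> \<^bold>\<not> b) (\<^bold>\<not> (a \<^bold>\<or> b))"
  and L_And_left: "entL (a \<^bold>\<and> b) a"
  and L_And_right: "entL (a \<^bold>\<and> b) b"
  and L_Or_left: "entL a (a \<^bold>\<or> b)"
  and L_Or_right: "entL b (a \<^bold>\<or> b)"
  and L_Imp_And: "entL ((a \<^bold>\<rightarrow> b) \<^bold>\<and> (a \<^bold>\<rightarrow> c)) (a \<^bold>\<rightarrow> (b \<^bold>\<and> c))"
  and L_Or_Imp: "entL ((a \<^bold>\<rightarrow> c) \<^bold>\<and> (b \<^bold>\<rightarrow> c)) ((a \<^bold>\<or> b) \<^bold>\<rightarrow> c)"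
  and L_distrib: "entL (a \<^bold>\<and> (b \<^bold>\<or> c)) ((a \<^bold>\<and> b) \<^bold>\<or> (a \<^bold>\<and> c))"
  and L_Box_And: "entL (\<^bold>\<box> a \<^bold>\<and> \<^bold>\<box> b) (\<^bold>\<box> (a \<^bold>\<and> b))"
  and L_BoxL_And: "entL (\<^bold>\<box>\<^sub>L a \<^bold>\<and> \<^bold>\<box>\<^sub>L b) (\<^bold>\<box>\<^sub>L (a \<^bold>\<and> b))"
  using BMC_instances[of a b c] unfolding BMC_axioms_def by (simp_all add: inst3_def)

sublocale L: entailment entL
proof
  fix a b c
  \<comment> \<open>Affixing turns a -> b into (b -> c) -> (a -> c), to which modus ponens under the
    box applies.\<close>
  show trans: "entL a c" if "entL a b" "entL b c" for a b c
    using L_mp[OF that(2) Imp_mono[OF that(1) L_refl]] .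
  show "entL c (a \<^bold>\<and> b)" if "entL c a" "entL c b" using L_mp L_adj that L_Imp_And by blast
  show "entL (a \<^bold>\<or> b) c" if "entL a c" "entL b c" using L_mp L_adj that L_Or_Imp by blast
qed (rule L_refl L_And_left L_And_right L_Or_left L_Or_right L_distrib)+

text \<open>This and the next two lemmas supply closure facts for the canonical relation:
  \<open>Imp_And_mono\<close> makes \<open>fuse\<close> a theory, \<open>Imp_Or_mono\<close> and
  \<open>Or_Imp_weaken\<close> make the avoided sets of \<open>prime_mid\<close> and
  \<open>prime_left\<close> directed.\<close>

lemma Imp_And_mono: "entL ((a \<^bold>\<rightarrow> b) \<^bold>\<and> (c \<^bold>\<rightarrow> d)) ((a \<^bold>\<and> c) \<^bold>\<rightarrow> (b \<^bold>\<and> d))"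
  by (rule L.trans[OF L.And_mono L_Imp_And]; rule Imp_mono; rule L_refl L_And_left L_And_right)

lemma Imp_Or_mono: "entL ((a \<^bold>\<rightarrow> b) \<^bold>\<and> (c \<^bold>\<rightarrow> d)) ((a \<^bold>\<or> c) \<^bold>\<rightarrow> (b \<^bold>\<or> d))"
  by (rule L.trans[OF L.And_mono L_Or_Imp]; rule Imp_mono; rule L_refl L_Or_left L_Or_right)

lemma Or_Imp_weaken: "entL ((a \<^bold>\<rightarrow> b) \<^bold>\<or> (c \<^bold>\<rightarrow> d)) ((a \<^bold>\<and> c) \<^bold>\<rightarrow> (b \<^bold>\<or> d))"
  by (rule L.Or_elim; rule Imp_mono; rule L_And_left L_And_right L_Or_left L_Or_right)

section \<open>Theorems contributed by the conditions in \<open>\<Phi>\<close>\<close>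

lemma L_DN:
  assumes "cDN \<in> \<Phi>" shows "entL a (\<^bold>\<not> (\<^bold>\<not> a))" "entL (\<^bold>\<not> (\<^bold>\<not> a)) a"
proof -
  have "L_thm ((a \<^bold>\<rightarrow> \<^bold>\<not> (\<^bold>\<not> a)) \<^bold>\<and> (\<^bold>\<not> (\<^bold>\<not> a) \<^bold>\<rightarrow> a))"
    by (rule cond_instance[OF assms, of "vp \<^bold>\<leftrightarrow> \<^bold>\<not> (\<^bold>\<not> vp)" a a a]) (simp_all add: inst3_def Iff_def)
  then show "entL a (\<^bold>\<not> (\<^bold>\<not> a))" "entL (\<^bold>\<not> (\<^bold>\<not> a)) a"
    using L_mp L_And_left L_And_right by blast+
qed

lemma cond_theorems:
  "cCp \<in> \<Phi> \<Longrightarrow> entL (a \<^bold>\<rightarrow> b) (\<^bold>\<not> b \<^bold>\<rightarrow> \<^bold>\<not> a)"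
  "cWB \<in> \<Phi> \<Longrightarrow> entL ((a \<^bold>\<rightarrow> b) \<^bold>\<and> (b \<^bold>\<rightarrow> c)) (a \<^bold>\<rightarrow> c)"
  "cX \<in> \<Phi> \<Longrightarrow> L_thm (a \<^bold>\<or> \<^bold>\<not> a)"
  "cRd \<in> \<Phi> \<Longrightarrow> entL (a \<^bold>\<rightarrow> \<^bold>\<not> a) (\<^bold>\<not> a)"
  "cB \<in> \<Phi> \<Longrightarrow> entL (a \<^bold>\<rightarrow> b) ((c \<^bold>\<rightarrow> a) \<^bold>\<rightarrow> (c \<^bold>\<rightarrow> b))"
  "cCB \<in> \<Phi> \<Longrightarrow> entL (a \<^bold>\<rightarrow> b) ((b \<^bold>\<rightarrow> c) \<^bold>\<rightarrow> (a \<^bold>\<rightarrow> c))"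
  "cW \<in> \<Phi> \<Longrightarrow> entL (a \<^bold>\<rightarrow> (a \<^bold>\<rightarrow> b)) (a \<^bold>\<rightarrow> b)"
  "cC \<in> \<Phi> \<Longrightarrow> entL (a \<^bold>\<rightarrow> (b \<^bold>\<rightarrow> c)) (b \<^bold>\<rightarrow> (a \<^bold>\<rightarrow> c))"
  "cM \<in> \<Phi> \<Longrightarrow> entL a (a \<^bold>\<rightarrow> a)"
  "cBoxK \<in> \<Phi> \<Longrightarrow> entL (\<^bold>\<box> (a \<^bold>\<rightarrow> b)) (\<^bold>\<box> a \<^bold>\<rightarrow> \<^bold>\<box> b)"
  "cBoxT \<in> \<Phi> \<Longrightarrow> entL (\<^bold>\<box> a) a"
  "cBoxD \<in> \<Phi> \<Longrightarrow> entL (\<^bold>\<box> (\<^bold>\<not> a)) (\<^bold>\<not> (\<^bold>\<box> a))"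
  "cBox4 \<in> \<Phi> \<Longrightarrow> entL (\<^bold>\<box> a) (\<^bold>\<box> (\<^bold>\<box> a))"
  "cBox5 \<in> \<Phi> \<Longrightarrow> entL (\<^bold>\<not> (\<^bold>\<box> a)) (\<^bold>\<box> (\<^bold>\<not> (\<^bold>\<box> a)))"
  by (erule cond_instance[where a = a and b = b and c = c], simp, simp add: inst3_def)+

lemma L_ER: "cER \<in> \<Phi> \<Longrightarrow> L_thm a \<Longrightarrow> entL (a \<^bold>\<rightarrow> b) b"
  and L_Nec: "cNec \<in> \<Phi> \<Longrightarrow> L_thm a \<Longrightarrow> L_thm (\<^bold>\<box> a)"
  by (erule L_rule1[rotated]; force simp: L_rules_def cond_rules_def)+

text \<open>This is the law behind R s s* s: if a lies in s*, then its negation is not in s, so a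
  prime s containing the disjunction must contain b.\<close>

lemma L_Rd_DN:
  assumes "cRd \<in> \<Phi>" "cDN \<in> \<Phi>"
  shows "entL (a \<^bold>\<rightarrow> b) (\<^bold>\<not> a \<^bold>\<or> b)"
proof -
  \<comment> \<open>The formula \<open>?r\<close> describes a counterexample to the implication.
    Under a -> b it implies its own negation, so the reductio axiom refutes it; De Morgan and double
    negation do the rest.\<close>
  let ?r = "a \<^bold>\<and> \<^bold>\<not> b"
  have "entL b (\<^bold>\<not> ?r)"
    using L.trans[OF L_DN(1)[OF assms(2)] Neg_antimono[OF L_And_right]] .
  then have "entL (a \<^bold>\<rightarrow> b) (?r \<^bold>\<rightarrow> \<^bold>\<not> ?r)" by (rule Imp_mono[OF L_And_left])
  also have "entL (?r \<^bold>\<rightarrow> \<^bold>\<not> ?r) (\<^bold>\<not> ?r)" by (rule cond_theorems(4)[OF assms(1)])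
  also (L.trans) have "entL (\<^bold>\<not> ?r) (\<^bold>\<not> a \<^bold>\<or> \<^bold>\<not> (\<^bold>\<not> b))" by (rule L_Neg_And)
  also (L.trans) have "entL (\<^bold>\<not> a \<^bold>\<or> \<^bold>\<not> (\<^bold>\<not> b)) (\<^bold>\<not> a \<^bold>\<or> b)" by (rule L.Or_mono[OF L_refl L_DN(2)[OF assms(2)]])
  finally (L.trans) show ?thesis .
qed

section \<open>The canonical frame\<close>

definition rel :: "fm set \<Rightarrow> fm set \<Rightarrow> fm set \<Rightarrow> bool" where
  "rel s t u \<longleftrightarrow> (\<forall>a b. a \<^bold>\<rightarrow> b \<in> s \<longrightarrow> a \<in> t \<longrightarrow> b \<in> u)"

text \<open>The least u with \<open>rel s t u\<close>. It is a theory when s and t are, but need not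
  be prime.\<close>

definition fuse :: "fm set \<Rightarrow> fm set \<Rightarrow> fm set" where
  "fuse s t = {b. \<exists>a\<in>t. a \<^bold>\<rightarrow> b \<in> s}"

text \<open>The Routley star on prime theories.\<close>

definition dual :: "fm set \<Rightarrow> fm set" where
  "dual s = {a. \<^bold>\<not> a \<notin> s}"

definition unbox :: "fm set \<Rightarrow> fm set" where
  "unbox s = {a. \<^bold>\<box> a \<in> s}"

definition unboxL :: "fm set \<Rightarrow> fm set" where
  "unboxL s = {a. \<^bold>\<box>\<^sub>L a \<in> s}"

lemma relI: "(\<And>a b. a \<^bold>\<rightarrow> b \<in> s \<Longrightarrow> a \<in> t \<Longrightarrow> b \<in> u) \<Longrightarrow> rel s t u"
  and relD: "rel s t u \<Longrightarrow> a \<^bold>\<rightarrow> b \<in> s \<Longrightarrow> a \<in> t \<Longrightarrow> b \<in> u"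
  and rel_mono: "rel s t u \<Longrightarrow> s' \<subseteq> s \<Longrightarrow> t' \<subseteq> t \<Longrightarrow> u \<subseteq> u' \<Longrightarrow> rel s' t' u'"
  unfolding rel_def by blast+

lemma rel_fuse: "rel s t (fuse s t)"
  by (auto simp: rel_def fuse_def)

lemma theory_fuse:
  assumes s: "L.is_theory s" and t: "L.is_theory t"
  shows "L.is_theory (fuse s t)"
proof (rule L.theoryI)
  fix a b assume "a \<in> fuse s t" "entL a b"
  then show "b \<in> fuse s t"
    unfolding fuse_def using L.theory_closed[OF s Imp_mono[OF L_refl]] by blast
next
  fix a b assume "a \<in> fuse s t" "b \<in> fuse s t"
  then show "a \<^bold>\<and> b \<in> fuse s t"
    unfolding fuse_def using L.theory_closed2[OF s Imp_And_mono] L.theory_And[OF t] by blast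
qed

lemma theory_unbox: "L.is_theory s \<Longrightarrow> L.is_theory (unbox s)"
  unfolding unbox_def
  by (rule L.theoryI) (auto intro: L.theory_closed[OF _ Box_mono] L.theory_closed2[OF _ L_Box_And])

lemma theory_unboxL: "L.is_theory s \<Longrightarrow> L.is_theory (unboxL s)"
  unfolding unboxL_def
  by (rule L.theoryI) (auto intro: L.theory_closed[OF _ BoxL_mono] L.theory_closed2[OF _ L_BoxL_And])

lemma prime_dual:
  assumes s: "L.prime s" shows "L.prime (dual s)"
proof (rule L.primeI, rule L.theoryI)
  note th = L.prime_theory[OF s]
  show "b \<in> dual s" if "a \<in> dual s" "entL a b" for a b
    using that L.theory_closed[OF th Neg_antimono] by (auto simp: dual_def)
  show "a \<^bold>\<and> b \<in> dual s" if "a \<in> dual s" "b \<in> dual s" for a b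
    using that L.theory_closed[OF th L_Neg_And] L.prime_Or[OF s] by (auto simp: dual_def)
  show "a \<in> dual s \<or> b \<in> dual s" if "a \<^bold>\<or> b \<in> dual s" for a b
    using that L.theory_closed2[OF th L_Neg_Or] by (auto simp: dual_def)
qed

section \<open>Squeeze lemmas: enlarging an argument of \<open>rel\<close> to a prime theory\<close>

lemma prime_left:
  assumes s: "L.is_theory s" and t: "L.is_theory t" and u: "L.prime u" and "rel s t u"
  obtains s' where "L.prime s'" "s \<subseteq> s'" "rel s' t u"
proof -
  \<comment> \<open>\<open>rel s' t u\<close> says precisely that s' avoids \<open>?D\<close>.
    Directedness conjoins antecedents, as t is a theory, and disjoins consequents, as u is
    prime.\<close>
  let ?D = "{a \<^bold>\<rightarrow> b | a b. a \<in> t \<and> b \<notin> u}"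
  have "L.directed ?D"
  proof (rule L.directedI)
    fix x y assume "x \<in> ?D" "y \<in> ?D"
    then obtain a b c d where *: "x = a \<^bold>\<rightarrow> b" "y = c \<^bold>\<rightarrow> d" "a \<in> t" "c \<in> t" "b \<notin> u" "d \<notin> u" by blast
    then have "(a \<^bold>\<and> c) \<^bold>\<rightarrow> (b \<^bold>\<or> d) \<in> ?D" using L.theory_And[OF t] L.prime_Or[OF u] by blast
    then show "\<exists>z\<in>?D. entL (x \<^bold>\<or> y) z" using * Or_Imp_weaken by blast
  qed
  moreover have "s \<inter> ?D = {}" using assms(4) by (auto simp: rel_def)
  ultimately obtain s' where "L.prime s'" "s \<subseteq> s'" "s' \<inter> ?D = {}"
    using L.prime_extension[OF s] by blast
  moreover from this have "rel s' t u" unfolding rel_def by blast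
  ultimately show thesis using that by blast
qed

lemma prime_mid:
  assumes s: "L.is_theory s" and t: "L.is_theory t" and u: "L.prime u" and "rel s t u"
  obtains t' where "L.prime t'" "t \<subseteq> t'" "rel s t' u"
proof -
  \<comment> \<open>Now the avoided formulas are the antecedents whose presence in t' would force
    something outside u; a disjunction of two of them forces the disjunction of the consequents,
    which a prime u omits too.\<close>
  let ?D = "{a. \<exists>b. a \<^bold>\<rightarrow> b \<in> s \<and> b \<notin> u}"
  have "L.directed ?D"
  proof (rule L.directedI)
    fix x y assume "x \<in> ?D" "y \<in> ?D"
    then obtain a b where *: "x \<^bold>\<rightarrow> a \<in> s" "y \<^bold>\<rightarrow> b \<in> s" "a \<notin> u" "b \<notin> u" by blast
    then have "x \<^bold>\<or> y \<in> ?D" using L.theory_closed2[OF s Imp_Or_mono] L.prime_Or[OF u] by blast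
    then show "\<exists>z\<in>?D. entL (x \<^bold>\<or> y) z" using L_refl by blast
  qed
  moreover have "t \<inter> ?D = {}" using assms(4) by (auto simp: rel_def)
  ultimately obtain t' where "L.prime t'" "t \<subseteq> t'" "t' \<inter> ?D = {}"
    using L.prime_extension[OF t] by blast
  moreover from this have "rel s t' u" unfolding rel_def by blast
  ultimately show thesis using that by blast
qed

lemma prime_avoiding:
  assumes "L.is_theory t" "a \<notin> t"
  obtains u where "L.prime u" "t \<subseteq> u" "a \<notin> u"
proof -
  have "L.directed {a}" using L.Or_elim L_refl by (auto intro: L.directedI)
  then show thesis using L.prime_extension[OF assms(1)] assms(2) that by blast
qed

definition L_theorems :: "fm set" where "L_theorems = {a. L_thm a}"

lemma theory_L_theorems: "L.is_theory L_theorems"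
  unfolding L_theorems_def using L_mp L_adj by (blast intro: L.theoryI)

lemma rel_L_theorems: "L.is_theory s \<Longrightarrow> rel L_theorems s s"
  unfolding L_theorems_def by (rule relI) (auto intro: L.theory_closed)

section \<open>Worlds and their existence\<close>

definition worlds :: "fm set set" where
  "worlds = {w. C.prime w \<and> w \<noteq> {} \<and> w \<noteq> UNIV}"

lemma worlds_prime: "w \<in> worlds \<Longrightarrow> C.prime w"
  by (simp add: worlds_def)

lemma worlds_theorem: "w \<in> worlds \<Longrightarrow> CL_thm a \<Longrightarrow> a \<in> w"
  using C.theory_closed[OF C.prime_theory entC_theorem] by (auto simp: worlds_def)

lemma worlds_Neg: assumes w: "w \<in> worlds" shows "\<^bold>\<not> a \<in> w \<longleftrightarrow> a \<notin> w"
proof -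
  note p = worlds_prime[OF w]
  obtain x y where "x \<in> w" "y \<notin> w" using w by (auto simp: worlds_def)
  then have "a \<^bold>\<or> \<^bold>\<not> a \<in> w" "\<not> (a \<in> w \<and> \<^bold>\<not> a \<in> w)"
    using C.theory_closed[OF C.prime_theory[OF p] entC_excluded_middle]
      C.theory_closed2[OF C.prime_theory[OF p] entC_contradiction] by blast+
  then show ?thesis using C.prime_Or[OF p] by blast
qed

lemma worlds_Imp: assumes w: "w \<in> worlds" shows "a \<^bold>\<rightarrow> b \<in> w \<longleftrightarrow> (a \<in> w \<longrightarrow> b \<in> w)"
proof -
  note th = C.prime_theory[OF worlds_prime[OF w]]
  show ?thesis
    using C.theory_closed2[OF th entC_mp] C.theory_closed[OF th entC_weaken]
      C.theory_closed[OF th entC_efq] worlds_Neg[OF w] by blast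
qed

lemma worlds_prime_L: "w \<in> worlds \<Longrightarrow> L.prime w"
  using worlds_prime CL_theorems.bridge
  by (auto simp: C.prime_def L.prime_def C.is_theory_def L.is_theory_def)

lemma world_avoiding:
  assumes D: "C.directed D" "D \<noteq> {}" and "\<And>a. a \<in> D \<Longrightarrow> \<not> CL_thm a"
  obtains w where "w \<in> worlds" "w \<inter> D = {}"
proof -
  have "C.is_theory {a. CL_thm a}"
    using CL_mp C.And_intro entC_theorem by (blast intro: C.theoryI)
  moreover have "{a. CL_thm a} \<inter> D = {}" using assms(3) by blast
  ultimately obtain w where "C.prime w" "{a. CL_thm a} \<subseteq> w" "w \<inter> D = {}"
    using C.prime_extension[OF _ D(1)] by blast
  \<comment> \<open>A theorem in w rules out \<open>{}\<close>, and a member of D outside w rules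
    out \<open>UNIV\<close>.\<close>
  moreover have "CL_thm (vp \<^bold>\<rightarrow> vp)" by (rule C.refl)
  ultimately have "w \<in> worlds" "w \<inter> D = {}" using D(2) by (auto simp: worlds_def)
  then show thesis by (rule that)
qed

text \<open>The world has to avoid all boxed formulas whose body is missing from s. These are
  directed for \<open>entC\<close>: monotonicity of the box is available under the box and the
  Bridge Rule brings it down to CL, while primeness of s keeps the disjunction outside s. For s =
  \<open>UNIV\<close> nothing has to be avoided, hence any world will do and one must be
  assumed.\<close>

lemma world_below:
  assumes s: "L.prime s" "L_theorems \<subseteq> s" and "worlds \<noteq> {}"
  shows "\<exists>w\<in>worlds. unboxL w \<subseteq> s"
proof (cases "s = UNIV")
  case True
  then show ?thesis using assms(3) by blast
next
  case False
  let ?D = "{\<^bold>\<box>\<^sub>L a | a. a \<notin> s}"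
  have "C.directed ?D"
  proof (rule C.directedI)
    fix x y assume "x \<in> ?D" "y \<in> ?D"
    then obtain a b where *: "x = \<^bold>\<box>\<^sub>L a" "y = \<^bold>\<box>\<^sub>L b" "a \<notin> s" "b \<notin> s" by blast
    have "entC x (\<^bold>\<box>\<^sub>L (a \<^bold>\<or> b))" "entC y (\<^bold>\<box>\<^sub>L (a \<^bold>\<or> b))"
      using * BoxL_mono[OF L_Or_left] BoxL_mono[OF L_Or_right] CL_theorems.bridge by blast+
    then have "entC (x \<^bold>\<or> y) (\<^bold>\<box>\<^sub>L (a \<^bold>\<or> b))" by (rule C.Or_elim)
    moreover have "\<^bold>\<box>\<^sub>L (a \<^bold>\<or> b) \<in> ?D" using * L.prime_Or[OF s(1)] by blast
    ultimately show "\<exists>z\<in>?D. entC (x \<^bold>\<or> y) z" by blast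
  qed
  moreover have "?D \<noteq> {}" using False by blast
  moreover have "\<not> CL_thm x" if "x \<in> ?D" for x using that s(2) by (auto simp: L_theorems_def)
  ultimately obtain w where "w \<in> worlds" "w \<inter> ?D = {}" using world_avoiding by blast
  then show ?thesis by (auto simp: unboxL_def)
qed

section \<open>The canonical frame is a W-frame\<close>

definition canon :: "fm set frame" where
  "canon = \<lparr>pts = {s. L.prime s},
    ord = {(s, t). L.prime s \<and> L.prime t \<and> s \<subseteq> t},
    ter = {(s, t, u). L.prime s \<and> L.prime t \<and> L.prime u \<and> rel s t u},
    star = dual,
    acc = {(s, t). L.prime s \<and> L.prime t \<and> unbox s \<subseteq> t},
    accL = {(s, t). L.prime s \<and> L.prime t \<and> unboxL s \<subseteq> t}\<rparr>"

lemma canon_simps [simp]: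
  "s \<in> pts canon \<longleftrightarrow> L.prime s"
  "(s, t) \<in> ord canon \<longleftrightarrow> L.prime s \<and> L.prime t \<and> s \<subseteq> t"
  "(s, t, u) \<in> ter canon \<longleftrightarrow> L.prime s \<and> L.prime t \<and> L.prime u \<and> rel s t u"
  "star canon = dual"
  "(s, t) \<in> acc canon \<longleftrightarrow> L.prime s \<and> L.prime t \<and> unbox s \<subseteq> t"
  "(s, t) \<in> accL canon \<longleftrightarrow> L.prime s \<and> L.prime t \<and> unboxL s \<subseteq> t"
  by (simp_all add: canon_def)

lemma canon_is_frame: "is_frame canon"
proof -
  have "partial_order_on (pts canon) (ord canon)"
    unfolding partial_order_on_def preorder_on_def
    by (auto simp: refl_on_def trans_def antisym_def)
  moreover have "ter canon \<subseteq> pts canon \<times> pts canon \<times> pts canon"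
    "acc canon \<subseteq> pts canon \<times> pts canon" "accL canon \<subseteq> pts canon \<times> pts canon"
    by (auto simp: canon_def)
  moreover have "star canon ` pts canon \<subseteq> pts canon" using prime_dual by auto
  moreover have "(s', t', u') \<in> ter canon"
    if "(s, t, u) \<in> ter canon \<and> (s', s) \<in> ord canon \<and> (t', t) \<in> ord canon \<and> (u, u') \<in> ord canon"
    for s t u s' t' u'
    using that rel_mono[of s t u s' t' u'] by simp
  moreover have "(star canon t, star canon s) \<in> ord canon" if "(s, t) \<in> ord canon" for s t
    using that prime_dual by (auto simp: dual_def)
  moreover have "(s', t') \<in> acc canon"
    if "(s, t) \<in> acc canon \<and> (s', s) \<in> ord canon \<and> (t, t') \<in> ord canon" for s t s' t'
    using that by (auto simp: unbox_def)
  moreover have "(s', t') \<in> accL canon"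
    if "(s, t) \<in> accL canon \<and> (s', s) \<in> ord canon \<and> (t, t') \<in> ord canon" for s t s' t'
    using that by (auto simp: unboxL_def)
  ultimately show ?thesis
    unfolding is_frame_def by blast
qed

lemma canon_bot: "bot_pt canon = {}" and canon_top: "top_pt canon = UNIV"
proof -
  show "bot_pt canon = {}"
    unfolding bot_pt_def by (rule the_equality) (use L.prime_empty in \<open>auto simp: is_least_def\<close>)
  show "top_pt canon = UNIV"
    unfolding top_pt_def by (rule the_equality) (use L.prime_UNIV in \<open>auto simp: is_greatest_def\<close>)
qed

lemma canon_bounded: "bounded_frame canon"
proof -
  have "is_least canon {}" "is_greatest canon UNIV"
    using L.prime_empty L.prime_UNIV by (auto simp: is_least_def is_greatest_def)
  moreover have "s = {} \<or> t = UNIV" if "rel UNIV s t" for s t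
    using that by (auto simp: rel_def)
  ultimately show ?thesis
    unfolding bounded_frame_def canon_bot canon_top canon_simps
    using canon_is_frame L.prime_empty L.prime_UNIV
    by (auto simp: dual_def unbox_def unboxL_def rel_def)
qed

lemma canon_L_points:
  assumes "worlds \<noteq> {}"
  shows "{s. \<exists>w\<in>worlds. (w, s) \<in> accL canon} = {s. L.prime s \<and> L_theorems \<subseteq> s}"
proof -
  have "L_theorems \<subseteq> unboxL w" if "w \<in> worlds" for w
    using worlds_theorem[OF that] by (auto simp: L_theorems_def unboxL_def)
  then show ?thesis using world_below[OF _ _ assms] worlds_prime_L by auto blast+
qed

lemma canon_world:
  assumes w: "w \<in> worlds" shows "possible_world canon w"
proof -
  have "dual w = w" using worlds_Neg[OF w] by (auto simp: dual_def)
  moreover have "rel w w w" using worlds_Imp[OF w] by (blast intro: relI)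
  \<comment> \<open>An implication with consequent in w, or with antecedent outside w, belongs to w.
    For a in s the first kind puts every b of w into t; an a in s but outside w puts every formula
    into t by the second.\<close>
  moreover have "s = {} \<or> w \<subseteq> t" "t = UNIV \<or> s \<subseteq> w" if "rel w s t" for s t
    using relD[OF that] worlds_Imp[OF w] by blast+
  ultimately show ?thesis
    using worlds_prime_L[OF w] by (simp add: possible_world_def canon_bot canon_top)
qed

lemma canon_W_frame:
  assumes "worlds \<noteq> {}" shows "W_frame canon worlds"
  unfolding W_frame_def
proof (intro conjI ballI allI impI)
  show "bounded_frame canon" by (rule canon_bounded)
next
  fix w assume "w \<in> worlds"
  then show "possible_world canon w" by (rule canon_world)
next
  fix w u s t assume w: "w \<in> worlds" and *: "(w, u) \<in> accL canon \<and> (u, s, t) \<in> ter canon"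
  then have "u \<in> {u. L.prime u \<and> L_theorems \<subseteq> u}" using canon_L_points[OF assms] by blast
  then have "a \<^bold>\<rightarrow> a \<in> u" for a using L_refl by (auto simp: L_theorems_def)
  then show "(s, t) \<in> ord canon" using * relD[of u s t] by auto
next
  fix s assume "s \<in> pts canon"
  then have s: "L.prime s" by simp
  note th = L.prime_theory[OF s]
  \<comment> \<open>\<open>L_theorems\<close> already stands in the relation to s, s but need not be
    prime; squeezing enlarges it to a point.\<close>
  obtain u where u: "L.prime u" "L_theorems \<subseteq> u" "rel u s s"
    using prime_left[OF theory_L_theorems th s rel_L_theorems[OF th]] .
  then have "u \<in> {u. \<exists>w\<in>worlds. (w, u) \<in> accL canon}" using canon_L_points[OF assms] by blast
  then show "\<exists>w\<in>worlds. \<exists>u. (w, u) \<in> accL canon \<and> (u, s, s) \<in> ter canon"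
    using u s canon_simps(3) by blast
qed

section \<open>The canonical valuation and the truth lemma\<close>

definition canon_val :: "nat \<Rightarrow> fm set set" where
  "canon_val n = {s. L.prime s \<and> Var n \<in> s}"

lemma canon_W_valuation: "W_valuation canon canon_val"
  using L.prime_UNIV
  by (auto simp: W_valuation_def up_set_def canon_val_def canon_bot canon_top)

text \<open>Start from the theory generated by a and the least third argument it allows, which
  misses b. The third argument is made prime first, since \<open>prime_mid\<close> needs a prime
  bound when it then enlarges the second.\<close>

lemma canon_Imp:
  assumes s: "L.prime s" and "a \<^bold>\<rightarrow> b \<notin> s"
  obtains t u where "L.prime t" "L.prime u" "rel s t u" "a \<in> t" "b \<notin> u"
proof -
  note th = L.prime_theory[OF s]
  let ?t = "{x. entL a x}"
  have t: "L.is_theory ?t" using L.trans L.And_intro by (blast intro: L.theoryI)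
  have "b \<notin> fuse s ?t"
  proof
    assume "b \<in> fuse s ?t"
    then obtain x where "entL a x" "x \<^bold>\<rightarrow> b \<in> s" by (auto simp: fuse_def)
    then show False using assms(2) L.theory_closed[OF th Imp_mono[OF _ L_refl]] by blast
  qed
  then obtain u where u: "L.prime u" "fuse s ?t \<subseteq> u" "b \<notin> u"
    using prime_avoiding[OF theory_fuse[OF th t]] by blast
  then have "rel s ?t u" using rel_mono[OF rel_fuse] by blast
  then obtain t' where "L.prime t'" "?t \<subseteq> t'" "rel s t' u" using prime_mid[OF th t u(1)] by blast
  then show thesis using that u L_refl by blast
qed

lemma canon_truth: "ext canon canon_val \<phi> = {s. L.prime s \<and> \<phi> \<in> s}"
proof (induction \<phi>)
  case (Neg \<phi>)
  then show ?case using prime_dual by (auto simp: dual_def)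
next
  case (And \<phi> \<psi>)
  then show ?case using L.prime_And_iff by auto
next
  case (Or \<phi> \<psi>)
  then show ?case using L.prime_Or_iff by auto
next
  case (Imp \<phi> \<psi>)
  show ?case
  proof (intro set_eqI iffI)
    fix s assume s: "s \<in> ext canon canon_val (\<phi> \<^bold>\<rightarrow> \<psi>)"
    then have "L.prime s" by simp
    with s show "s \<in> {s. L.prime s \<and> \<phi> \<^bold>\<rightarrow> \<psi> \<in> s}"
      using canon_Imp[of s \<phi> \<psi>] Imp by fastforce
  next
    fix s assume "s \<in> {s. L.prime s \<and> \<phi> \<^bold>\<rightarrow> \<psi> \<in> s}"
    then show "s \<in> ext canon canon_val (\<phi> \<^bold>\<rightarrow> \<psi>)" using Imp relD[of s _ _ \<phi> \<psi>] by auto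
  qed
next
  case (Box \<phi>)
  have "\<exists>t. L.prime t \<and> unbox s \<subseteq> t \<and> \<phi> \<notin> t" if "L.prime s" "\<^bold>\<box> \<phi> \<notin> s" for s
    using prime_avoiding[OF theory_unbox[OF L.prime_theory[OF that(1)]], of \<phi>] that(2)
    by (auto simp: unbox_def)
  then show ?case using Box by (auto simp: unbox_def)
next
  case (BoxL \<phi>)
  have "\<exists>t. L.prime t \<and> unboxL s \<subseteq> t \<and> \<phi> \<notin> t" if "L.prime s" "\<^bold>\<box>\<^sub>L \<phi> \<notin> s" for s
    using prime_avoiding[OF theory_unboxL[OF L.prime_theory[OF that(1)]], of \<phi>] that(2)
    by (auto simp: unboxL_def)
  then show ?case using BoxL by (auto simp: unboxL_def)
qed (auto simp: canon_val_def)

section \<open>Canonicity of the conditions\<close>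

lemmas prime_closed = L.theory_closed[OF L.prime_theory]

abbreviation L_primes :: "fm set set" where
  "L_primes \<equiv> {s. L.prime s \<and> L_theorems \<subseteq> s}"

text \<open>For conditions that assert an intermediate point, it remains to check the relation for
  \<open>fuse s t\<close>, which is then enlarged to a prime theory. Here that point is a second
  argument; \<open>rel_compose_left\<close> treats it as a first argument.\<close>

lemma rel_compose:
  assumes "L.is_theory s" "L.is_theory t" "L.is_theory s'" "L.prime u" "rel s' (fuse s t) u"
  shows "\<exists>x. L.prime x \<and> rel s t x \<and> rel s' x u"
proof -
  obtain x where "L.prime x" "fuse s t \<subseteq> x" "rel s' x u"
    using prime_mid[OF assms(3) theory_fuse[OF assms(1,2)] assms(4,5)] .
  moreover from this have "rel s t x" using rel_mono[OF rel_fuse] by blast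
  ultimately show ?thesis by blast
qed

lemma rel_compose_left:
  assumes "L.is_theory s" "L.is_theory t" "L.is_theory t'" "L.prime u" "rel (fuse s t) t' u"
  shows "\<exists>x. L.prime x \<and> rel s t x \<and> rel x t' u"
proof -
  obtain x where "L.prime x" "fuse s t \<subseteq> x" "rel x t' u"
    using prime_left[OF theory_fuse[OF assms(1,2)] assms(3-5)] .
  moreover from this have "rel s t x" using rel_mono[OF rel_fuse] by blast
  ultimately show ?thesis by blast
qed

lemma canon_cDN:
  assumes c: "cDN \<in> \<Phi>"
  shows "cond_holds canon L_primes cDN"
proof -
  have "dual (dual s) = s" if "L.prime s" for s
    unfolding dual_def using prime_closed[OF that] L_DN c by blast
  then show ?thesis
    by simp
qed

lemma canon_cCp:
  assumes c: "cCp \<in> \<Phi>"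
  shows "cond_holds canon L_primes cCp"
proof -
  have "rel s (dual u) (dual t)" if s: "L.prime s" and r: "rel s t u" for s t u
  proof (rule relI)
    fix a b assume "a \<^bold>\<rightarrow> b \<in> s" "a \<in> dual u"
    then show "b \<in> dual t" using prime_closed[OF s cond_theorems(1)] relD[OF r] c by (auto simp: dual_def)
  qed
  then show ?thesis
    using prime_dual by simp
qed

lemma canon_cWB:
  assumes c: "cWB \<in> \<Phi>"
  shows "cond_holds canon L_primes cWB"
proof -
  have "\<exists>x. L.prime x \<and> rel s t x \<and> rel s x u"
    if s: "L.prime s" and t: "L.prime t" and u: "L.prime u" and r: "rel s t u" for s t u
  proof -
    have "rel s (fuse s t) u"
    proof (rule relI)
      fix b d assume "b \<^bold>\<rightarrow> d \<in> s" "b \<in> fuse s t"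
      then obtain a where "b \<^bold>\<rightarrow> d \<in> s" "a \<in> t" "a \<^bold>\<rightarrow> b \<in> s" by (auto simp: fuse_def)
      then show "d \<in> u"
        using L.theory_closed2[OF L.prime_theory[OF s] cond_theorems(2), of a b d] relD[OF r, of a d] c by simp
    qed
    then show ?thesis by (rule rel_compose[OF L.prime_theory[OF s] L.prime_theory[OF t] L.prime_theory[OF s] u])
  qed
  then show ?thesis
    unfolding cond_holds.simps canon_simps Ball_def Bex_def by blast
qed

lemma canon_cX:
  assumes c: "cX \<in> \<Phi>"
  shows "cond_holds canon L_primes cX"
proof -
  have "dual s \<subseteq> s" if "L.prime s" "L_theorems \<subseteq> s" for s
    using that cond_theorems(3) c L.prime_Or[OF that(1)] by (auto simp: dual_def L_theorems_def)
  then show ?thesis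
    using prime_dual by simp
qed

lemma canon_cRd:
  assumes c: "cRd \<in> \<Phi>" and DN: "cDN \<in> \<Phi>"
  shows "cond_holds canon L_primes cRd"
proof -
  have "rel s (dual s) s" if s: "L.prime s" for s
  proof (rule relI)
    fix a b assume "a \<^bold>\<rightarrow> b \<in> s" "a \<in> dual s"
    moreover have "entL (a \<^bold>\<rightarrow> b) (\<^bold>\<not> a \<^bold>\<or> b)" using L_Rd_DN DN c by blast
    ultimately show "b \<in> s" using prime_closed[OF s] L.prime_Or[OF s] by (auto simp: dual_def)
  qed
  then show ?thesis
    using prime_dual by simp
qed

lemma canon_cB:
  assumes c: "cB \<in> \<Phi>"
  shows "cond_holds canon L_primes cB"
proof -
  have "\<exists>y. L.prime y \<and> rel t u y \<and> rel s y v"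
    if s: "L.prime s" and t: "L.prime t" and u: "L.prime u" and v: "L.prime v"
      and r: "rel s t x" "rel x u v" for s t u v x
  proof -
    have "rel s (fuse t u) v"
    proof (rule relI)
      fix b d assume "b \<^bold>\<rightarrow> d \<in> s" "b \<in> fuse t u"
      then obtain a where "b \<^bold>\<rightarrow> d \<in> s" "a \<in> u" "a \<^bold>\<rightarrow> b \<in> t" by (auto simp: fuse_def)
      then show "d \<in> v" using prime_closed[OF s cond_theorems(5)] relD[OF r(1)] relD[OF r(2)] c by blast
    qed
    then show ?thesis by (rule rel_compose[OF L.prime_theory[OF t] L.prime_theory[OF u] L.prime_theory[OF s] v])
  qed
  then show ?thesis
    unfolding cond_holds.simps canon_simps Ball_def Bex_def by blast
qed

lemma canon_cCB:
  assumes c: "cCB \<in> \<Phi>"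
  shows "cond_holds canon L_primes cCB"
proof -
  have "\<exists>y. L.prime y \<and> rel s u y \<and> rel t y v"
    if s: "L.prime s" and t: "L.prime t" and u: "L.prime u" and v: "L.prime v"
      and r: "rel s t x" "rel x u v" for s t u v x
  proof -
    have "rel t (fuse s u) v"
    proof (rule relI)
      fix b d assume "b \<^bold>\<rightarrow> d \<in> t" "b \<in> fuse s u"
      then obtain a where "b \<^bold>\<rightarrow> d \<in> t" "a \<in> u" "a \<^bold>\<rightarrow> b \<in> s" by (auto simp: fuse_def)
      then show "d \<in> v" using prime_closed[OF s cond_theorems(6)] relD[OF r(1)] relD[OF r(2)] c by blast
    qed
    then show ?thesis by (rule rel_compose[OF L.prime_theory[OF s] L.prime_theory[OF u] L.prime_theory[OF t] v])
  qed
  then show ?thesis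
    unfolding cond_holds.simps canon_simps Ball_def Bex_def by blast
qed

lemma canon_cW:
  assumes c: "cW \<in> \<Phi>"
  shows "cond_holds canon L_primes cW"
proof -
  have "\<exists>x. L.prime x \<and> rel s t x \<and> rel x t u"
    if s: "L.prime s" and t: "L.prime t" and u: "L.prime u" and r: "rel s t u" for s t u
  proof -
    have "rel (fuse s t) t u"
    proof (rule relI)
      fix b d assume "b \<^bold>\<rightarrow> d \<in> fuse s t" and b: "b \<in> t"
      then obtain a where a: "a \<in> t" "a \<^bold>\<rightarrow> (b \<^bold>\<rightarrow> d) \<in> s" by (auto simp: fuse_def)
      \<comment> \<open>Contraction needs equal antecedents, but a and b may differ; both are
        strengthened to their conjunction, which still lies in t.\<close>
      let ?e = "a \<^bold>\<and> b"
      have "entL (a \<^bold>\<rightarrow> (b \<^bold>\<rightarrow> d)) (?e \<^bold>\<rightarrow> (?e \<^bold>\<rightarrow> d))"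
        by (rule Imp_mono[OF L_And_left Imp_mono[OF L_And_right L_refl]])
      then have "?e \<^bold>\<rightarrow> d \<in> s" using a(2) prime_closed[OF s] cond_theorems(7) c by blast
      then show "d \<in> u" using relD[OF r] L.theory_And[OF L.prime_theory[OF t] a(1) b] by blast
    qed
    then show ?thesis by (rule rel_compose_left[OF L.prime_theory[OF s] L.prime_theory[OF t] L.prime_theory[OF t] u])
  qed
  then show ?thesis
    unfolding cond_holds.simps canon_simps Ball_def Bex_def by blast
qed

lemma canon_cC:
  assumes c: "cC \<in> \<Phi>"
  shows "cond_holds canon L_primes cC"
proof -
  have "\<exists>y. L.prime y \<and> rel s u y \<and> rel y t v"
    if s: "L.prime s" and t: "L.prime t" and u: "L.prime u" and v: "L.prime v"
      and r: "rel s t x" "rel x u v" for s t u v x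
  proof -
    have "rel (fuse s u) t v"
    proof (rule relI)
      fix b d assume "b \<^bold>\<rightarrow> d \<in> fuse s u" "b \<in> t"
      then obtain a where "b \<in> t" "a \<in> u" "a \<^bold>\<rightarrow> (b \<^bold>\<rightarrow> d) \<in> s" by (auto simp: fuse_def)
      then show "d \<in> v" using prime_closed[OF s cond_theorems(8)] relD[OF r(1)] relD[OF r(2)] c by blast
    qed
    then show ?thesis by (rule rel_compose_left[OF L.prime_theory[OF s] L.prime_theory[OF u] L.prime_theory[OF t] v])
  qed
  then show ?thesis
    unfolding cond_holds.simps canon_simps Ball_def Bex_def by blast
qed

lemma canon_cM:
  assumes c: "cM \<in> \<Phi>"
  shows "cond_holds canon L_primes cM"
proof -
  have "s \<subseteq> u \<or> t \<subseteq> u"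
    if s: "L.prime s" and t: "L.prime t" and u: "L.prime u" and r: "rel s t u" for s t u
  proof (rule ccontr)
    assume "\<not> (s \<subseteq> u \<or> t \<subseteq> u)"
    then obtain a b where *: "a \<in> s" "a \<notin> u" "b \<in> t" "b \<notin> u" by blast
    \<comment> \<open>The axiom is used at the disjunction, the one formula that a puts into s and b
      puts into t, while primeness keeps it out of u.\<close>
    then have "(a \<^bold>\<or> b) \<^bold>\<rightarrow> (a \<^bold>\<or> b) \<in> s" "a \<^bold>\<or> b \<in> t"
      using prime_closed[OF s cond_theorems(9)] prime_closed[OF s L_Or_left] prime_closed[OF t L_Or_right] c by blast+
    then show False using relD[OF r] L.prime_Or[OF u] * by blast
  qed
  then show ?thesis
    by simp
qed

text \<open>The rule says that \<open>L_theorems\<close> itself works as the middle argument;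
  squeezing makes it prime.\<close>

lemma canon_cER:
  assumes c: "cER \<in> \<Phi>"
  shows "cond_holds canon L_primes cER"
proof -
  have "\<exists>x. L.prime x \<and> L_theorems \<subseteq> x \<and> rel s x s" if s: "L.prime s" for s
  proof -
    have "rel s L_theorems s"
      using prime_closed[OF s L_ER] c by (auto simp: rel_def L_theorems_def)
    from prime_mid[OF L.prime_theory[OF s] theory_L_theorems s this] show ?thesis by blast
  qed
  then show ?thesis
    unfolding cond_holds.simps canon_simps Ball_def Bex_def by blast
qed

lemma canon_cNec:
  assumes c: "cNec \<in> \<Phi>"
  shows "cond_holds canon L_primes cNec"
proof -
  have "L_theorems \<subseteq> s" if "L_theorems \<subseteq> x" "unbox x \<subseteq> s" for x s
    using that L_Nec c by (auto simp: L_theorems_def unbox_def)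
  then show ?thesis
    unfolding cond_holds.simps canon_simps Ball_def Bex_def by blast
qed

lemma canon_cBoxK:
  assumes c: "cBoxK \<in> \<Phi>"
  shows "cond_holds canon L_primes cBoxK"
proof -
  have "\<exists>y. (t, y) \<in> acc canon \<and> (\<exists>z. (s, z) \<in> acc canon \<and> (z, y, u) \<in> ter canon)"
    if "(s, t, x) \<in> ter canon" "(x, u) \<in> acc canon" for s t u x
  proof -
    from that have s: "L.prime s" and t: "L.prime t" and u: "L.prime u"
      and r: "rel s t x" "unbox x \<subseteq> u" by simp_all
    note ths = theory_unbox[OF L.prime_theory[OF s]] and tht = theory_unbox[OF L.prime_theory[OF t]]
    have "rel (unbox s) (unbox t) u"
    proof (rule relI)
      fix a b assume "a \<^bold>\<rightarrow> b \<in> unbox s" "a \<in> unbox t"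
      then have "\<^bold>\<box> b \<in> x"
        using prime_closed[OF s cond_theorems(10)] relD[OF r(1)] c by (auto simp: unbox_def)
      then show "b \<in> u" using r(2) by (auto simp: unbox_def)
    qed
    \<comment> \<open>The arguments are squeezed one at a time against the prime u, the second now
      and the first afterwards with y in place.\<close>
    then obtain y where y: "L.prime y" "unbox t \<subseteq> y" "rel (unbox s) y u"
      by (rule prime_mid[OF ths tht u])
    obtain z where z: "L.prime z" "unbox s \<subseteq> z" "rel z y u"
      using prime_left[OF ths L.prime_theory[OF y(1)] u y(3)] .
    have "(t, y) \<in> acc canon" "(s, z) \<in> acc canon" "(z, y, u) \<in> ter canon"
      using s t u y z by simp_all
    then show ?thesis by blast
  qed
  then show ?thesis
    unfolding cond_holds.simps by blast
qed

lemma canon_cBoxT: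
  assumes c: "cBoxT \<in> \<Phi>"
  shows "cond_holds canon L_primes cBoxT"
proof -
  have "unbox s \<subseteq> s" if s: "L.prime s" for s
    using prime_closed[OF s cond_theorems(11)] c by (auto simp: unbox_def)
  then show ?thesis
    by simp
qed

lemma canon_cBoxD:
  assumes c: "cBoxD \<in> \<Phi>" and DN: "cDN \<in> \<Phi>"
  shows "cond_holds canon L_primes cBoxD"
proof -
  have "\<exists>x\<in>pts canon. (s, star canon x) \<in> acc canon \<and> (star canon s, x) \<in> acc canon"
    if s: "L.prime s" for s
  proof -
    let ?D = "{\<^bold>\<not> a | a. \<^bold>\<box> a \<in> s}"
    have "L.directed ?D"
    proof (rule L.directedI)
      fix x y assume "x \<in> ?D" "y \<in> ?D"
      then obtain a b where *: "x = \<^bold>\<not> a" "y = \<^bold>\<not> b" "\<^bold>\<box> a \<in> s" "\<^bold>\<box> b \<in> s" by blast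
      then have "entL (x \<^bold>\<or> y) (\<^bold>\<not> (a \<^bold>\<and> b))"
        using L.Or_elim Neg_antimono L_And_left L_And_right by blast
      then show "\<exists>z\<in>?D. entL (x \<^bold>\<or> y) z"
        using L.theory_closed2[OF L.prime_theory[OF s] L_Box_And *(3,4)] by blast
    qed
    moreover have "unbox (dual s) \<inter> ?D = {}"
    proof -
      have "\<^bold>\<not> (\<^bold>\<box> (\<^bold>\<not> a)) \<in> s" if "\<^bold>\<box> a \<in> s" for a
        using prime_closed[OF s L.trans[OF Box_mono[OF L_DN(1)] cond_theorems(12)]] that DN c by blast
      then show ?thesis by (auto simp: unbox_def dual_def)
    qed
    ultimately obtain x where "L.prime x" "unbox (dual s) \<subseteq> x" "x \<inter> ?D = {}"
      using L.prime_extension[OF theory_unbox[OF L.prime_theory[OF prime_dual[OF s]]]] by blast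
    moreover from this have "unbox s \<subseteq> dual x" by (auto simp: unbox_def dual_def)
    ultimately show ?thesis using s prime_dual by auto
  qed
  then show ?thesis by simp
qed

lemma canon_cBox4:
  assumes c: "cBox4 \<in> \<Phi>"
  shows "cond_holds canon L_primes cBox4"
proof -
  have "unbox s \<subseteq> u" if s: "L.prime s" and "unbox s \<subseteq> t" "unbox t \<subseteq> u" for s t u
    using that prime_closed[OF s cond_theorems(13)] c by (auto simp: unbox_def)
  then show ?thesis
    unfolding cond_holds.simps canon_simps Ball_def Bex_def by blast
qed

lemma canon_cBox5:
  assumes c: "cBox5 \<in> \<Phi>"
  shows "cond_holds canon L_primes cBox5"
proof -
  have "unbox (dual t) \<subseteq> u" if s: "L.prime s" and "unbox (dual s) \<subseteq> u" "unbox s \<subseteq> t" for s t u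
    using that prime_closed[OF s cond_theorems(14)] c by (auto simp: unbox_def dual_def)
  then show ?thesis
    using prime_dual by simp
qed

lemma canon_cond:
  assumes "worlds \<noteq> {}" "c \<in> \<Phi>" "c = cBoxD \<or> c = cRd \<Longrightarrow> cDN \<in> \<Phi>"
  shows "cond_holds canon {s. \<exists>w\<in>worlds. (w, s) \<in> accL canon} c"
  unfolding canon_L_points[OF assms(1)] using assms(2,3)
  by (cases c) (simp_all only: canon_cDN canon_cCp canon_cWB canon_cX canon_cRd canon_cB canon_cCB
      canon_cW canon_cC canon_cM canon_cER canon_cNec canon_cBoxK canon_cBoxT canon_cBoxD
      canon_cBox4 canon_cBox5 simp_thms)

section \<open>Completeness\<close>

lemma canon_CL_frame:
  assumes W: "worlds \<noteq> {}"
    and BoxD: "cBoxD \<in> \<Phi> \<longrightarrow> cDN \<in> \<Phi>"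
    and Rd: "cRd \<in> \<Phi> \<longrightarrow> cDN \<in> \<Phi> \<or> {cCp, cX, cC, cM} \<subseteq> \<Phi>"
  shows "CL_frame \<Phi> canon worlds"
proof -
  interpret W_structure canon worlds using canon_W_frame[OF W] by unfold_locales
  have "cond_holds canon L_points c" if c: "c \<in> \<Phi>" for c
  proof (cases "c = cRd \<and> cDN \<notin> \<Phi>")
    case True
    then have "cCp \<in> \<Phi>" "cX \<in> \<Phi>" "cC \<in> \<Phi>" "cM \<in> \<Phi>" using c Rd by auto
    then have "cond_holds canon L_points cRd"
      by (intro Rd_from_Cp_X_C_M canon_cond[OF W]) simp_all
    then show ?thesis using True by blast
  next
    case False
    then show ?thesis using canon_cond[OF W c] BoxD c by blast
  qed
  then show ?thesis using canon_W_frame[OF W] by (simp add: CL_frame_def)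
qed

text \<open>A non-theorem is missing from some world. This gives both the refuting point and the
  nonemptiness of \<open>worlds\<close> on which the canonical frame depends.\<close>

lemma completeness:
  assumes BoxD: "cBoxD \<in> \<Phi> \<longrightarrow> cDN \<in> \<Phi>"
    and Rd: "cRd \<in> \<Phi> \<longrightarrow> cDN \<in> \<Phi> \<or> {cCp, cX, cC, cM} \<subseteq> \<Phi>"
    and valid: "\<phi> \<in> CL_logic TYPE(fm set) \<Phi>"
  shows "CL_thm \<phi>"
proof (rule ccontr)
  assume no: "\<not> CL_thm \<phi>"
  have "C.directed {\<phi>}" using C.Or_elim C.refl by (auto intro: C.directedI)
  then obtain w where w: "w \<in> worlds" "\<phi> \<notin> w" using world_avoiding[of "{\<phi>}"] no by blast
  then have "CL_frame \<Phi> canon worlds" using canon_CL_frame BoxD Rd by blast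
  then have "worlds \<subseteq> ext canon canon_val \<phi>"
    using valid canon_W_valuation by (auto simp: CL_logic_def valid_in_frame_def)
  then show False using w by (auto simp: canon_truth)
qed

end

theorem theorem5p10:
  fixes \<Phi> :: "cond set"
  assumes "cBoxD \<in> \<Phi> \<longrightarrow> cDN \<in> \<Phi>"
    and "cRd \<in> \<Phi> \<longrightarrow> cDN \<in> \<Phi> \<or> {cCp, cX, cC, cM} \<subseteq> \<Phi>"
  shows "CL_theorems \<Phi> = CL_logic TYPE(fm set) \<Phi> \<and> CL_theorems \<Phi> \<subseteq> CL_logic TYPE('s) \<Phi>"
proof (intro conjI equalityI)
  show "CL_logic TYPE(fm set) \<Phi> \<subseteq> CL_theorems \<Phi>"
    using CL_system.completeness[OF assms] by (rule subsetI)
qed (rule soundness[OF assms(1)])+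

end
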